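(* Let $\{a_m\}_{m\ge0}$ be a real sequence with $a_m\to0$ as $m\to\infty$. Then the function $u$ given by the harmonic extension to each cell $\overline Y_m$, $m\ge1$, of the values $u(q_1)=a_0$, $u(x_m)=a_m$ $(m\ge1)$, $$u(y_1)=\frac15\Big(a_0+a_1+18\sum_{k=2}^\infty\frac1{3^k}a_k\Big),$$ and, for $m\ge2$, $$u(y_m)=\frac1{5^m}\Big(a_0-\frac97\sum_{k=1}^\infty\frac1{3^k}a_k+\frac27\sum_{k=1}^m5^ka_k\Big)+\frac97\sum_{k=1}^\infty\frac1{3^k}a_{m+k},$$ solves the boundary value problem $\Delta u=0$ on $\Omega$, $u(q_1)=a_0$, $u(x_m)=a_m$ $(m\ge1)$. Furthermore, this function is the unique solution in $C(\overline\Omega)$.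
   Context: Let $q_0,q_1,q_2$ be the vertices of an equilateral triangle, $F_j(x)=(x+q_j)/2$, and let $SG$ be the Sierpinski gasket, the nonempty compact set with $SG=\bigcup_{j=0}^2F_jSG$. A cell of level $m$ is $F_{w_1}\cdots F_{w_m}SG$; its boundary points are $F_{w_1}\cdots F_{w_m}q_j$, $j=0,1,2$. Half gasket: $x_m=F_0^{m-1}F_2q_1$ ($m\ge1$), $y_m=F_0^mq_1$ ($m\ge0$, so $y_0=q_1$), $\overline Y_m=F_0^{m-1}F_1SG$ ($m\ge 1$), a level-$m$ cell with boundary points $y_{m-1},y_m,x_m$. Put $X=\{x_m\}_{m\ge1}$, $\overline\Omega=\{q_0\}\cup\bigcup_{m\ge1}\overline Y_m$, $\partial\Omega=\{q_0,q_1\}\cup X$, $\Omega=\overline\Omega\setminus\partial\Omega$. A function on a cell is harmonic if it is the continuous function determined by its values at the three boundary points $v_0,v_1,v_2$ through the harmonic extension algorithm: at the level-one-finer junction point between $v_i$ and $v_j$ it takes the value $(2u(v_i)+2u(v_j)+u(v_k))/5$ ($\{i,j,k\}=\{0,1,2\}$), and this is iterated on all smaller cells. $\Delta$ is the Kigami Laplacian for the standard measure. "$\Delta u=0$ on $\Omega$" means: $u$ is harmonic on each cell $\overline Y_m$, and at each $y_m$, $m\ge1$, the normal derivatives match: $$\Big(\tfrac53\Big)^m[2u(y_m)-u(y_{m-1})-u(x_m)]+\Big(\tfrac53\Big)^{m+1}[2u(y_m)-u(y_{m+1})-u(x_{m+1})]=0 .$$ No value is prescribed at $q_0$; the function $u$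 is understood to be given its limiting value at $q_0$. *)

theory Defs
  imports "HOL-Analysis.Analysis"
begin

section \<open>The Sierpinski gasket\<close>

text \<open>Only \<open>q 0\<close>, \<open>q 1\<close>, \<open>q 2\<close> are used.\<close>

definition equilateral :: "(nat \<Rightarrow> real^2) \<Rightarrow> bool" where
  "equilateral q \<longleftrightarrow>
     (\<exists>d>0. \<forall>i\<in>{0,1,2}. \<forall>j\<in>{0,1,2}. i \<noteq> j \<longrightarrow> dist (q i) (q j) = d)"

definition F :: "(nat \<Rightarrow> real^2) \<Rightarrow> nat \<Rightarrow> real^2 \<Rightarrow> real^2" where
  "F q j x = (1/2) *\<^sub>R (x + q j)"

definition SG :: "(nat \<Rightarrow> real^2) \<Rightarrow> (real^2) set" where
  "SG q = (THE K. compact K \<and> K \<noteq> {} \<and> K = (\<Union>j\<in>{0,1,2}. F q j ` K))"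

text \<open>The definite description is well defined, for arbitrary \<open>q\<close>.\<close>

lemma continuous_on_F: "continuous_on S (F q j)"
  unfolding F_def by (intro continuous_intros)

lemma dist_F: "dist (F q j x) (F q j y) = dist x y / 2"
  by (simp add: F_def dist_norm flip: scaleR_diff_right)

lemma inj_F: "inj (F q j)"
  by (auto simp: inj_def F_def)

lemma self_similar_subset:
  assumes K: "compact K" "K = (\<Union>j\<in>{0,1,2}. F q j ` K)"
    and L: "compact L" "L \<noteq> {}" "L = (\<Union>j\<in>{0,1,2}. F q j ` L)"
  shows "K \<subseteq> L"
proof (cases "K = {}")
  case False
  have "continuous_on K (\<lambda>x. infdist x L)" by (intro continuous_intros)
  then obtain m where m: "m \<in> K" "\<And>x. x \<in> K \<Longrightarrow> infdist x L \<le> infdist m L"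
    using continuous_attains_sup[OF K(1) False] by blast
  obtain j y where j: "j \<in> {0,1,2}" and y: "y \<in> K" "m = F q j y"
    using m(1) K(2) by blast
  obtain z where z: "z \<in> L" "infdist y L = dist y z"
    using infdist_attains_inf[OF compact_imp_closed[OF L(1)] L(2)] by blast
  have "F q j z \<in> L" using L(3) z(1) j by blast
  then have "infdist m L \<le> dist y z / 2"
    using infdist_le[of "F q j z" L m] by (simp add: y(2) dist_F)
  also have "\<dots> \<le> infdist m L / 2" using m(2)[OF y(1)] z(2) by simp
  finally have "infdist m L \<le> 0" by simp
  then have "infdist x L = 0" if "x \<in> K" for x
    using m(2)[OF that] infdist_nonneg[of x L] by linarith
  then show ?thesis
    using in_closed_iff_infdist_zero[OF compact_imp_closed[OF L(1)] L(2)] by blast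
qed simp

lemma self_similar_exists:
  "\<exists>K. compact K \<and> K \<noteq> {} \<and> K = (\<Union>j\<in>{0,1,2}. F q j ` K)"
proof -
  define \<Phi> where "\<Phi> A = (\<Union>j\<in>{0,1,2}. F q j ` A)" for A
  define R where "R = max (norm (q 0)) (max (norm (q 1)) (norm (q 2)))"
  define T where "T n = (\<Phi> ^^ n) (cball 0 R)" for n :: nat
  have T_Suc: "T (Suc n) = \<Phi> (T n)" for n by (simp add: T_def)
  have mono: "\<Phi> A \<subseteq> \<Phi> B" if "A \<subseteq> B" for A B using that by (auto simp: \<Phi>_def)
  have comp: "compact (T n)" for n
  proof (induction n)
    case (Suc n)
    then show ?case unfolding T_Suc \<Phi>_def
      by (intro compact_UN compact_continuous_image continuous_on_F) auto
  qed (simp add: T_def)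
  have "R \<ge> 0" by (simp add: R_def le_max_iff_disj)
  then have ne: "T n \<noteq> {}" for n
    by (induction n) (simp_all add: T_Suc \<Phi>_def, simp add: T_def)
  have "norm (F q j x) \<le> R" if "norm x \<le> R" "j \<in> {0,1,2}" for j x
  proof -
    have "norm (q j) \<le> R" using that(2) by (auto simp: R_def le_max_iff_disj)
    then show ?thesis
      using that(1) norm_triangle_ineq[of x "q j"] by (simp add: F_def)
  qed
  then have step: "T (Suc n) \<subseteq> T n" for n
  proof (induction n)
    case 0
    then show ?case by (fastforce simp: T_def \<Phi>_def)
  next
    case (Suc n)
    then show ?case using mono by (simp add: T_Suc)
  qed
  have dec: "T n \<subseteq> T m" if "m \<le> n" for m n
    using lift_Suc_antimono_le[of T, OF step that] .
  define K where "K = (\<Inter>n. T n)"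
  have "K = \<Phi> K"
  proof
    show "\<Phi> K \<subseteq> K"
    proof -
      have "\<Phi> K \<subseteq> T n" for n
        using mono[of K "T n"] step[of n] T_Suc[of n] by (auto simp: K_def)
      then show ?thesis by (auto simp: K_def)
    qed
    show "K \<subseteq> \<Phi> K"
    proof (rule ccontr)
      assume "\<not> K \<subseteq> \<Phi> K"
      then obtain x where x: "x \<in> K" "x \<notin> \<Phi> K" by blast
      have "\<exists>n. x \<notin> F q j ` T n" if j: "j \<in> {0,1,2}" for j
      proof (rule ccontr)
        assume "\<nexists>n. x \<notin> F q j ` T n"
        then have all: "\<forall>n. \<exists>y\<in>T n. x = F q j y" by blast
        then obtain y where y: "x = F q j y" by blast
        have "y \<in> T n" for n
          using all y inj_F[of q j] by (metis injD)
        then have "y \<in> K" by (simp add: K_def)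
        then show False using x(2) y j by (auto simp: \<Phi>_def)
      qed
      then obtain N where N: "\<And>j. j \<in> {0,1,2} \<Longrightarrow> x \<notin> F q j ` T (N j)" by metis
      define M where "M = N 0 + N 1 + N 2"
      have "x \<in> \<Phi> (T M)" using x(1) T_Suc[of M] by (auto simp: K_def)
      then obtain j where j: "j \<in> {0,1,2}" "x \<in> F q j ` T M" by (auto simp: \<Phi>_def)
      then have "N j \<le> M" by (auto simp: M_def)
      then show False using N[OF j(1)] j(2) dec by blast
    qed
  qed
  moreover have "compact K" unfolding K_def using comp
    by (intro compact_Inter) auto
  moreover have "K \<noteq> {}" unfolding K_def
    using compact_nest[of T] comp ne dec by simp
  ultimately show ?thesis unfolding \<Phi>_def by blast
qed

lemma SG: "compact (SG q)" "SG q \<noteq> {}" "SG q = (\<Union>j\<in>{0,1,2}. F q j ` SG q)"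
proof -
  have "\<exists>!K. compact K \<and> K \<noteq> {} \<and> K = (\<Union>j\<in>{0,1,2}. F q j ` K)"
    using self_similar_exists self_similar_subset by (metis subset_antisym)
  from theI'[OF this] show
    "compact (SG q)" "SG q \<noteq> {}" "SG q = (\<Union>j\<in>{0,1,2}. F q j ` SG q)"
    unfolding SG_def by blast+
qed

text \<open>\<open>Fw q [w\<^sub>1, \<dots>, w\<^sub>m]\<close> is the composition of \<open>F q w\<^sub>1\<close>, \dots, \<open>F q w\<^sub>m\<close>,
  with \<open>F q w\<^sub>m\<close> applied first.\<close>

definition Fw :: "(nat \<Rightarrow> real^2) \<Rightarrow> nat list \<Rightarrow> real^2 \<Rightarrow> real^2" where
  "Fw q w = foldr (F q) w"

definition cell :: "(nat \<Rightarrow> real^2) \<Rightarrow> nat list \<Rightarrow> (real^2) set" where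
  "cell q w = Fw q w ` SG q"

text \<open>Continuity together with the extension rule on every subcell: \<open>F q i (q j)\<close> is the midpoint
  of \<open>q i\<close> and \<open>q j\<close>, so \<open>Fw q (w @ v) (F q i (q j))\<close> is the junction point, one level finer,
  between the boundary points \<open>i\<close> and \<open>j\<close> of the cell \<open>w @ v\<close>.\<close>

definition harmonic_on_cell :: "(nat \<Rightarrow> real^2) \<Rightarrow> nat list \<Rightarrow> (real^2 \<Rightarrow> real) \<Rightarrow> bool" where
  "harmonic_on_cell q w u \<longleftrightarrow>
     continuous_on (cell q w) u \<and>
     (\<forall>v\<in>lists {0,1,2}. \<forall>i j k. {i,j,k} = {0,1,2} \<longrightarrow>
        u (Fw q (w @ v) (F q i (q j))) =
          (2 * u (Fw q (w @ v) (q i)) + 2 * u (Fw q (w @ v) (q j)) + u (Fw q (w @ v) (q k))) / 5)"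


section \<open>The half gasket\<close>

text \<open>\<open>x_pt q m\<close> and \<open>Y_word m\<close> are meant for \<open>m \<ge> 1\<close> only.\<close>

definition x_pt :: "(nat \<Rightarrow> real^2) \<Rightarrow> nat \<Rightarrow> real^2" where
  "x_pt q m = (F q 0 ^^ (m - 1)) (F q 2 (q 1))"

definition y_pt :: "(nat \<Rightarrow> real^2) \<Rightarrow> nat \<Rightarrow> real^2" where
  "y_pt q m = (F q 0 ^^ m) (q 1)"

definition Y_word :: "nat \<Rightarrow> nat list" where
  "Y_word m = replicate (m - 1) 0 @ [1]"

text \<open>The boundary points of the cell with word \<open>Y_word m\<close>.\<close>

lemma Y_word_boundary:
  assumes "m \<ge> 1"
  shows "Fw q (Y_word m) (q 0) = y_pt q m" "Fw q (Y_word m) (q 1) = y_pt q (m - 1)"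
    "Fw q (Y_word m) (q 2) = x_pt q m"
proof -
  have rep: "foldr (F q) (replicate n 0) = F q 0 ^^ n" for n
    by (induction n) auto
  have mid: "F q 1 (q 0) = F q 0 (q 1)" "F q 1 (q 1) = q 1" "F q 1 (q 2) = F q 2 (q 1)"
    by (simp_all add: F_def add.commute flip: scaleR_2)
  obtain n where "m = Suc n" using assms by (cases m) auto
  then show "Fw q (Y_word m) (q 0) = y_pt q m" "Fw q (Y_word m) (q 1) = y_pt q (m - 1)"
    "Fw q (Y_word m) (q 2) = x_pt q m"
    using mid by (simp_all add: Fw_def Y_word_def y_pt_def x_pt_def rep funpow_swap1)
qed

definition Omega_bar :: "(nat \<Rightarrow> real^2) \<Rightarrow> (real^2) set" where
  "Omega_bar q = {q 0} \<union> (\<Union>m\<in>{1..}. cell q (Y_word m))"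

text \<open>\<open>\<Delta>u = 0\<close> on \<open>\<Omega>\<close>, the half gasket without \<open>q 0\<close>, \<open>q 1\<close> and the points \<open>x_pt q m\<close>.
  The junctions of the cells are the points \<open>y_pt q m\<close>, where the two outward normal derivatives
  have to cancel.\<close>

definition laplacian_zero :: "(nat \<Rightarrow> real^2) \<Rightarrow> (real^2 \<Rightarrow> real) \<Rightarrow> bool" where
  "laplacian_zero q u \<longleftrightarrow>
     (\<forall>m\<ge>1. harmonic_on_cell q (Y_word m) u) \<and>
     (\<forall>m\<ge>1. (5/3) ^ m * (2 * u (y_pt q m) - u (y_pt q (m - 1)) - u (x_pt q m)) +
        (5/3) ^ (m + 1) * (2 * u (y_pt q m) - u (y_pt q (m + 1)) - u (x_pt q (m + 1))) = 0)"

text \<open>No value is prescribed at \<open>q 0\<close>.\<close>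

definition solves_bvp :: "(nat \<Rightarrow> real^2) \<Rightarrow> (nat \<Rightarrow> real) \<Rightarrow> (real^2 \<Rightarrow> real) \<Rightarrow> bool" where
  "solves_bvp q a u \<longleftrightarrow>
     laplacian_zero q u \<and> u (q 1) = a 0 \<and> (\<forall>m\<ge>1. u (x_pt q m) = a m)"

definition y_value :: "(nat \<Rightarrow> real) \<Rightarrow> nat \<Rightarrow> real" where
  "y_value a m =
     (if m = 1 then 1/5 * (a 0 + a 1 + 18 * (\<Sum>k. 1 / 3 ^ (k + 2) * a (k + 2)))
      else 1 / 5 ^ m * (a 0 - 9/7 * (\<Sum>k. 1 / 3 ^ (k + 1) * a (k + 1))
                            + 2/7 * (\<Sum>k=1..m. 5 ^ k * a k))
           + 9/7 * (\<Sum>k. 1 / 3 ^ (k + 1) * a (m + (k + 1))))"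

text \<open>\<open>u\<close> is, on the half gasket, the function obtained by harmonic extension to each cell of
  the given values at the points \<open>q 1\<close>, \<open>x_pt q m\<close>, \<open>y_pt q m\<close>, with its limiting value at \<open>q 0\<close>.
  Since \<open>Lim\<close> is a total operator, the last conjunct does not assert that the limit exists.\<close>

definition extends_values :: "(nat \<Rightarrow> real^2) \<Rightarrow> (nat \<Rightarrow> real) \<Rightarrow> (real^2 \<Rightarrow> real) \<Rightarrow> bool" where
  "extends_values q a u \<longleftrightarrow>
     (\<forall>m\<ge>1. harmonic_on_cell q (Y_word m) u) \<and>
     u (q 1) = a 0 \<and> (\<forall>m\<ge>1. u (x_pt q m) = a m) \<and> (\<forall>m\<ge>1. u (y_pt q m) = y_value a m) \<and>
     u (q 0) = Lim (at (q 0) within Omega_bar q) u"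

end

theory Submission
  imports Defs
begin

text \<open>On the chain of cells \<open>Y_word m\<close> the problem is one-dimensional. Once the values at all
  boundary points of these cells are known, harmonic extension determines the function, so only the
  numbers \<open>u (y_pt q m)\<close> are free. Cleared of its powers of \<open>5/3\<close>, the matching condition is the
  linear recurrence
  \<open>5 y (m + 1) - 16 y m + 3 y (m - 1) = - 3 a m - 5 a (m + 1)\<close>
  (\<open>solves_bvp_iff\<close>), whose characteristic roots are \<open>3\<close> and \<open>1/5\<close>. Its general solution is a
  particular one plus \<open>A 3\<^sup>m + B 5\<^sup>-\<^sup>m\<close>. The formula in \<open>y_value\<close> is the solution with value \<open>a 0\<close> at
  \<open>m = 0\<close> without a growing part: the past of \<open>a\<close> enters through the decaying mode
  (\<open>head_sum\<close>), the future of \<open>a\<close> through the growing mode read backwards (\<open>tail_sum\<close>). As \<open>a\<close> tends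
  to \<open>0\<close>, so do both sums, hence \<open>y_value\<close> (\<open>y_value_tendsto\<close>).

  Two facts about harmonic functions on a single cell are needed. They obey the maximum principle
  (\<open>harmonic_on_cell_bound\<close>), because the extension rule takes convex combinations and the vertices
  are dense. And every choice of three boundary values has a continuous harmonic extension
  (\<open>harmonic_extension_exists\<close>), because one refinement step shrinks the oscillation of
  the boundary values by the factor \<open>3/5\<close>.

  Consecutive cells of the half gasket share one point \<open>y_pt q m\<close> and other cells are disjoint, so
  extensions with the same values there fit together (\<open>harmonic_function_with_values\<close>). By the
  maximum principle the function is small on all cells close to \<open>q 0\<close>, since its boundary values
  are; this gives the limit \<open>0\<close> and continuity at \<open>q 0\<close>. For uniqueness, the
  difference of two continuous solutions has values \<open>A (3\<^sup>m - 5\<^sup>-\<^sup>m)\<close> at the points \<open>y_pt q m\<close>; these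
  values converge because \<open>y_pt q m\<close> tends to \<open>q 0\<close>, so \<open>A = 0\<close>
  (\<open>bounded_recurrence_zero\<close>), and the maximum principle makes the difference vanish on every cell.\<close>

section \<open>Words, vertices and cells\<close>

lemma Fw_Nil: "Fw q [] x = x" and Fw_Cons: "Fw q (i # w) x = F q i (Fw q w x)"
  and Fw_append: "Fw q (w @ v) x = Fw q w (Fw q v x)"
  by (simp_all add: Fw_def)

lemma F_vertex: "F q i (q i) = q i"
  by (simp add: F_def flip: scaleR_2)

lemma inj_Fw: "inj (Fw q w)"
  by (induction w) (auto simp: inj_def Fw_Nil Fw_Cons inj_eq[OF inj_F])

lemma dist_Fw: "dist (Fw q w x) (Fw q w y) = dist x y / 2 ^ length w"
  by (induction w) (simp_all add: Fw_Nil Fw_Cons dist_F)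

lemma continuous_on_Fw: "continuous_on S (Fw q w)"
proof (induction w)
  case (Cons i w)
  then show ?case
    using continuous_on_compose[OF Cons.IH continuous_on_F[of _ q i]]
    by (simp add: Fw_def)
qed (simp add: Fw_def id_def)

lemma F_in_SG: "F q i x \<in> SG q" if "i \<in> {0,1,2}" "x \<in> SG q"
  using SG(3)[of q] that by blast

lemma Fw_in_SG: "Fw q w x \<in> SG q" if "w \<in> lists {0,1,2}" "x \<in> SG q"
  using that by (induction w) (simp_all add: Fw_Nil Fw_Cons F_in_SG)

text \<open>The map \<open>F q i\<close> halves distances to \<open>q i\<close>, so a point of the gasket nearest to \<open>q i\<close> has
  distance \<open>0\<close> from it.\<close>

lemma vertex_in_SG:
  assumes i: "i \<in> {0,1,2}"
  shows "q i \<in> SG q"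
proof -
  obtain z where z: "z \<in> SG q" "infdist (q i) (SG q) = dist (q i) z"
    using infdist_attains_inf[OF compact_imp_closed[OF SG(1)] SG(2)] by blast
  have "dist (q i) z \<le> dist (q i) (F q i z)"
    using infdist_le[OF F_in_SG[OF i z(1)], of "q i"] z(2) by simp
  also have "\<dots> = dist (q i) z / 2"
    using dist_F[of q i "q i" z] by (simp add: F_vertex)
  finally show ?thesis using z(1) by simp
qed

lemma SG_in_small_cell:
  assumes "x \<in> SG q"
  shows "\<exists>v\<in>lists {0,1,2}. \<exists>z\<in>SG q. length v = n \<and> x = Fw q v z"
  using assms
proof (induction n arbitrary: x)
  case 0
  then show ?case by (auto simp: Fw_Nil intro!: bexI[of _ "[]"])
next
  case (Suc n)
  obtain i y where i: "i \<in> {0,1,2}" and y: "y \<in> SG q" "x = F q i y"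
    using Suc.prems SG(3)[of q] by blast
  obtain v z where "v \<in> lists {0,1,2}" "z \<in> SG q" "length v = n" "y = Fw q v z"
    using Suc.IH[OF y(1)] by blast
  then show ?case using i y(2) by (intro bexI[of _ "i # v"] bexI[of _ z]) (auto simp: Fw_Cons)
qed

text \<open>A cell of level \<open>n\<close> has \<open>2\<^sup>-\<^sup>n\<close> times the diameter of the gasket and contains the image
  of \<open>q 0\<close>; small cells through \<open>x\<close> therefore supply the approximating vertices.\<close>

lemma vertices_dense:
  assumes x: "x \<in> SG q" and "e > 0"
  obtains v where "v \<in> lists {0,1,2}" "dist (Fw q v (q 0)) x < e"
proof -
  have "bounded (SG q)" by (rule compact_imp_bounded[OF SG(1)])
  then obtain R where R: "\<And>z. z \<in> SG q \<Longrightarrow> dist (q 0) z \<le> R"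
    using bounded_any_center[of "SG q" "q 0"] by blast
  \<comment> \<open>cells of level \<open>n\<close> have radius at most \<open>R / 2 ^ n\<close> about the image of \<open>q 0\<close>\<close>
  obtain n where n: "R / e < 2 ^ n" using real_arch_pow[of 2 "R / e"] by auto
  obtain v z where v: "v \<in> lists {0,1,2}" "z \<in> SG q" "length v = n" "x = Fw q v z"
    using SG_in_small_cell[OF x, of n] by blast
  have "dist (Fw q v (q 0)) x \<le> R / 2 ^ n"
    using R[OF v(2)] v(3,4) by (simp add: dist_Fw divide_right_mono)
  also have "\<dots> < e" using n \<open>e > 0\<close> by (simp add: field_simps)
  finally show ?thesis using that v(1) by blast
qed

section \<open>Harmonic functions on a cell\<close>

lemma third_vertex:
  assumes "i \<in> {0,1,2::nat}" "j \<in> {0,1,2}" "i \<noteq> j"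
  obtains k where "{i,j,k} = {0,1,2}"
proof -
  have "{i,j,3 - i - j} = {0,1,2}" using assms by auto
  then show ?thesis by (rule that)
qed

lemma harmonic_on_cell_junction:
  assumes "harmonic_on_cell q w u" "v \<in> lists {0,1,2}" "{i,j,k} = {0,1,2}"
  shows "u (Fw q (w @ v) (F q i (q j))) =
    (2 * u (Fw q (w @ v) (q i)) + 2 * u (Fw q (w @ v) (q j)) + u (Fw q (w @ v) (q k))) / 5"
  using conjunct2[OF assms(1)[unfolded harmonic_on_cell_def], rule_format, OF assms(2,3)] .

text \<open>Every point that occurs in the extension rule lies in the cell, so the property depends only on
  the values there. This lets a function glued from pieces inherit harmonicity from each piece.\<close>

lemma harmonic_on_cell_cong:
  assumes u: "harmonic_on_cell q w u" and eq: "\<And>x. x \<in> cell q w \<Longrightarrow> u x = v x"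
  shows "harmonic_on_cell q w v"
  unfolding harmonic_on_cell_def
proof (intro conjI ballI allI impI)
  show "continuous_on (cell q w) v"
    using u eq by (simp add: harmonic_on_cell_def cong: continuous_on_cong)
next
  fix s :: "nat list" and i j k assume s: "s \<in> lists {0,1,2}" and ijk: "{i,j,k} = {0,1,2::nat}"
  have pt: "u (Fw q (w @ s) x) = v (Fw q (w @ s) x)" if "x \<in> SG q" for x
    using Fw_in_SG[OF s that] by (intro eq) (auto simp: cell_def Fw_append)
  have i: "i \<in> {0,1,2}" and j: "j \<in> {0,1,2}" and k: "k \<in> {0,1,2}" using ijk by blast+
  show "v (Fw q (w @ s) (F q i (q j))) =
      (2 * v (Fw q (w @ s) (q i)) + 2 * v (Fw q (w @ s) (q j)) + v (Fw q (w @ s) (q k))) / 5"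
    using harmonic_on_cell_junction[OF u s ijk]
    unfolding pt[OF F_in_SG[OF i vertex_in_SG[OF j]]] pt[OF vertex_in_SG[OF i]]
      pt[OF vertex_in_SG[OF j]] pt[OF vertex_in_SG[OF k]] .
qed

lemma harmonic_on_cell_diff:
  assumes "harmonic_on_cell q w u" "harmonic_on_cell q w v"
  shows "harmonic_on_cell q w (\<lambda>x. u x - v x)"
  unfolding harmonic_on_cell_def
proof (intro conjI ballI allI impI)
  show "continuous_on (cell q w) (\<lambda>x. u x - v x)"
    using assms by (intro continuous_on_diff) (auto simp: harmonic_on_cell_def)
next
  fix s :: "nat list" and i j k assume *: "s \<in> lists {0,1,2}" "{i,j,k} = {0,1,2::nat}"
  from harmonic_on_cell_junction[OF assms(1) *] harmonic_on_cell_junction[OF assms(2) *]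
  show "u (Fw q (w @ s) (F q i (q j))) - v (Fw q (w @ s) (F q i (q j))) =
    (2 * (u (Fw q (w @ s) (q i)) - v (Fw q (w @ s) (q i))) +
     2 * (u (Fw q (w @ s) (q j)) - v (Fw q (w @ s) (q j))) +
     (u (Fw q (w @ s) (q k)) - v (Fw q (w @ s) (q k)))) / 5"
    by (simp add: field_simps)
qed

text \<open>The maximum principle. The weights \<open>2/5, 2/5, 1/5\<close> of the extension rule are nonnegative
  with sum \<open>1\<close>, so the bound passes from the boundary to the vertices of all levels; density and
  continuity carry it to the whole cell.\<close>

lemma harmonic_on_cell_bound:
  assumes u: "harmonic_on_cell q w u"
    and bd: "\<And>i. i \<in> {0,1,2} \<Longrightarrow> \<bar>u (Fw q w (q i))\<bar> \<le> M"
    and x: "x \<in> cell q w"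
  shows "\<bar>u x\<bar> \<le> M"
proof -
  have vert: "\<bar>u (Fw q (w @ v) (q i))\<bar> \<le> M" if "v \<in> lists {0,1,2}" "i \<in> {0,1,2}" for v i
    using that
  proof (induction v arbitrary: i rule: rev_induct)
    case Nil
    then show ?case using bd by simp
  next
    case (snoc j v)
    have v: "v \<in> lists {0,1,2}" and j: "j \<in> {0,1,2}" using snoc.prems by auto
    note IH = snoc.IH[OF v]
    have snoc_eq: "Fw q (w @ v @ [j]) (q i) = Fw q (w @ v) (F q j (q i))"
      by (simp add: Fw_append Fw_Cons Fw_Nil)
    show ?case
    proof (cases "i = j")
      case True
      then show ?thesis using IH[OF j] snoc_eq by (simp add: F_vertex)
    next
      case False
      then obtain k where k: "{j,i,k} = {0,1,2}"
        using third_vertex[OF j snoc.prems(2)] by auto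
      then have "k \<in> {0,1,2}" by blast
      have avg: "\<bar>a\<bar> \<le> M" if "a = (2 * b + 2 * c + d) / 5"
        "\<bar>b\<bar> \<le> M" "\<bar>c\<bar> \<le> M" "\<bar>d\<bar> \<le> M" for a b c d :: real
        using that by (simp add: abs_le_iff)
      have "u (Fw q (w @ v) (F q j (q i))) = (2 * u (Fw q (w @ v) (q j))
          + 2 * u (Fw q (w @ v) (q i)) + u (Fw q (w @ v) (q k))) / 5"
        by (rule harmonic_on_cell_junction[OF u v k])
      then show ?thesis
        unfolding snoc_eq by (rule avg[OF _ IH[OF j] IH[OF snoc.prems(2)] IH[OF \<open>k \<in> {0,1,2}\<close>]])
    qed
  qed
  obtain z where z: "z \<in> SG q" "x = Fw q w z" using x by (auto simp: cell_def)
  have cont: "continuous_on (SG q) (\<lambda>z. u (Fw q w z))"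
    using u continuous_on_compose[OF continuous_on_Fw, of q w "SG q" u]
    by (simp add: harmonic_on_cell_def cell_def o_def)
  show ?thesis
  proof (rule ccontr)
    assume "\<not> \<bar>u x\<bar> \<le> M"
    then have "\<bar>u x\<bar> - M > 0" by simp
    then obtain e where e: "e > 0"
      "\<And>y. y \<in> SG q \<Longrightarrow> dist y z < e \<Longrightarrow> dist (u (Fw q w y)) (u (Fw q w z)) < \<bar>u x\<bar> - M"
      using cont z(1) unfolding continuous_on_iff by blast
    obtain v where v: "v \<in> lists {0,1,2}" "dist (Fw q v (q 0)) z < e"
      using vertices_dense[OF z(1) e(1)] .
    have "\<bar>u (Fw q w (Fw q v (q 0)))\<bar> \<le> M"
      using vert[OF v(1), of 0] by (simp add: Fw_append)
    moreover have "dist (u (Fw q w (Fw q v (q 0)))) (u x) < \<bar>u x\<bar> - M"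
      using e(2)[OF Fw_in_SG[OF v(1) vertex_in_SG[of 0 q]] v(2)] z(2) by simp
    ultimately show False by (simp add: dist_real_def)
  qed
qed

lemma harmonic_on_cell_unique:
  assumes u: "harmonic_on_cell q w u" and v: "harmonic_on_cell q w v"
    and bd: "\<And>i. i \<in> {0,1,2} \<Longrightarrow> u (Fw q w (q i)) = v (Fw q w (q i))"
    and x: "x \<in> cell q w"
  shows "u x = v x"
  using harmonic_on_cell_bound[OF harmonic_on_cell_diff[OF u v] _ x, of 0] bd by simp

section \<open>Barycentric coordinates\<close>

locale equilateral_vertices =
  fixes q :: "nat \<Rightarrow> real^2"
  assumes equilateral: "equilateral q"
begin

text \<open>The \<open>i\<close>-th barycentric coordinate with respect to the triangle. The quadratic parts of the
  squared distances cancel, so this is affine in \<open>x\<close>; in an equilateral triangle the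
  normalisation makes it \<open>1\<close> at \<open>q i\<close> and \<open>0\<close> at the other two vertices. With this form no
  coordinates of the plane need to be chosen.\<close>

definition bary :: "nat \<Rightarrow> real^2 \<Rightarrow> real" where
  "bary i x = 1/3 + ((\<Sum>j\<in>{0,1,2}. (dist x (q j))\<^sup>2) - 3 * (dist x (q i))\<^sup>2) / (3 * (dist (q 0) (q 1))\<^sup>2)"

lemma dist_vertices:
  assumes "i \<in> {0,1,2}" "j \<in> {0,1,2}" "i \<noteq> j"
  shows "dist (q i) (q j) = dist (q 0) (q 1)" "dist (q 0) (q 1) > 0"
proof -
  obtain d where d: "d > 0" "\<forall>i\<in>{0,1,2}. \<forall>j\<in>{0,1,2}. i \<noteq> j \<longrightarrow> dist (q i) (q j) = d"
    using equilateral unfolding equilateral_def by blast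
  have "dist (q i) (q j) = d" "dist (q 0) (q 1) = d" using d(2)[rule_format, OF assms] d(2)[rule_format, of 0 1] by simp_all
  then show "dist (q i) (q j) = dist (q 0) (q 1)" "dist (q 0) (q 1) > 0" using d(1) by simp_all
qed

lemma bary_vertex:
  assumes "i \<in> {0,1,2}" "j \<in> {0,1,2}"
  shows "bary i (q j) = (if i = j then 1 else 0)"
proof -
  define d where "d = dist (q 0) (q 1)"
  have d: "d > 0" using dist_vertices(2)[of 0 1] by (simp add: d_def)
  have *: "dist (q i) (q j) = (if i = j then 0 else d)" if "i \<in> {0,1,2}" "j \<in> {0,1,2}" for i j
    using dist_vertices(1)[OF that] by (auto simp: d_def)
  have "(\<Sum>k\<in>{0,1,2}. (dist (q j) (q k))\<^sup>2) = (\<Sum>k\<in>{0,1,2}. if j = k then 0 else d\<^sup>2)"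
    using assms by (intro sum.cong) (auto simp: *)
  also have "\<dots> = 2 * d\<^sup>2" using assms(2) by auto
  finally show ?thesis
    using d *[OF assms(2,1)] unfolding bary_def d_def[symmetric] by (auto simp: field_simps)
qed

lemma sum_bary: "(\<Sum>i\<in>{0,1,2}. bary i x) = 1"
  using dist_vertices(2)[of 0 1] by (simp add: bary_def field_simps)

text \<open>The identity \<open>par\<close> is the parallelogram law for the midpoint \<open>F q j x\<close> of \<open>x\<close> and \<open>q j\<close>. Its last
  term does not depend on \<open>z\<close> and cancels in the combination that defines \<open>bary\<close>.\<close>

lemma bary_F:
  assumes "i \<in> {0,1,2}" "j \<in> {0,1,2}"
  shows "bary i (F q j x) = (bary i x + (if i = j then 1 else 0)) / 2"
proof -
  have par: "(dist (F q j x) z)\<^sup>2 = ((dist x z)\<^sup>2 + (dist (q j) z)\<^sup>2) / 2 - (dist x (q j))\<^sup>2 / 4" for z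
    unfolding F_def dist_norm power2_norm_eq_inner
    by (simp add: inner_simps inner_commute field_simps)
  have "(\<Sum>k\<in>{0,1,2}. (dist (F q j x) (q k))\<^sup>2) - 3 * (dist (F q j x) (q i))\<^sup>2 =
      (((\<Sum>k\<in>{0,1,2}. (dist x (q k))\<^sup>2) - 3 * (dist x (q i))\<^sup>2) +
       ((\<Sum>k\<in>{0,1,2}. (dist (q j) (q k))\<^sup>2) - 3 * (dist (q j) (q i))\<^sup>2)) / 2"
    unfolding par by (simp add: field_simps)
  then have "bary i (F q j x) = (bary i x + bary i (q j)) / 2"
    unfolding bary_def by (simp add: add_divide_distrib)
  then show ?thesis using bary_vertex[OF assms] by simp
qed

lemma continuous_on_bary: "continuous_on S (bary i)"
  unfolding bary_def using dist_vertices(2)[of 0 1] by (intro continuous_intros) auto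

text \<open>A minimum point is of the form \<open>F q j y\<close>, where the coordinate is at least half its value at
  \<open>y\<close>, hence at least half the minimum; so the minimum is not negative.\<close>

lemma bary_nonneg:
  assumes i: "i \<in> {0,1,2}" and x: "x \<in> SG q"
  shows "bary i x \<ge> 0"
proof -
  obtain m where m: "m \<in> SG q" "\<And>x. x \<in> SG q \<Longrightarrow> bary i m \<le> bary i x"
    using continuous_attains_inf[OF SG(1,2) continuous_on_bary] by metis
  obtain j y where j: "j \<in> {0,1,2}" and y: "y \<in> SG q" "m = F q j y"
    using m(1) SG(3)[of q] by blast
  have "bary i m \<ge> bary i m / 2" using bary_F[OF i j, of y] m(2)[OF y(1)] y(2) by auto
  then show ?thesis using m(2)[OF x] by simp
qed

lemma bary_le_1:
  assumes "i \<in> {0,1,2}" "x \<in> SG q"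
  shows "bary i x \<le> 1"
  using sum_bary[of x] bary_nonneg[OF _ assms(2), of 0] bary_nonneg[OF _ assms(2), of 1]
    bary_nonneg[OF _ assms(2), of 2] assms(1) by auto

text \<open>The distance between the two sides is halved by each map \<open>F q j\<close>, so its maximum over the
  self-similar set is at most half of itself.\<close>

lemma SG_barycentric:
  assumes x: "x \<in> SG q"
  shows "x = (\<Sum>i\<in>{0,1,2}. bary i x *\<^sub>R q i)"
proof -
  define g where "g x = norm (x - (\<Sum>i\<in>{0,1,2}. bary i x *\<^sub>R q i))" for x
  have g_F: "g (F q j x) = g x / 2" if j: "j \<in> {0,1,2}" for j x
  proof -
    have "(\<Sum>i\<in>{0,1,2}. bary i (F q j x) *\<^sub>R q i) =
        (1/2) *\<^sub>R ((\<Sum>i\<in>{0,1,2}. bary i x *\<^sub>R q i) + q j)"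
    proof -
      have "(\<Sum>i\<in>{0,1,2}. bary i (F q j x) *\<^sub>R q i) =
          (\<Sum>i\<in>{0,1,2}. ((bary i x + (if i = j then 1 else 0)) / 2) *\<^sub>R q i)"
        by (rule sum.cong) (simp_all only: bary_F[OF _ j])
      then show ?thesis using j by (auto simp: algebra_simps add_divide_distrib)
    qed
    then have "F q j x - (\<Sum>i\<in>{0,1,2}. bary i (F q j x) *\<^sub>R q i) =
        (1/2) *\<^sub>R (x - (\<Sum>i\<in>{0,1,2}. bary i x *\<^sub>R q i))"
      by (simp only: F_def scaleR_diff_right[symmetric] add_diff_cancel_right)
    then show ?thesis unfolding g_def by (simp only: norm_scaleR real_norm_def)
  qed
  have "continuous_on (SG q) g"
    unfolding g_def by (intro continuous_intros continuous_on_bary)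
  then obtain m where m: "m \<in> SG q" "\<And>x. x \<in> SG q \<Longrightarrow> g x \<le> g m"
    using continuous_attains_sup[OF SG(1,2)] by metis
  obtain j y where j: "j \<in> {0,1,2}" and y: "y \<in> SG q" "m = F q j y"
    using m(1) SG(3)[of q] by blast
  have "g m \<le> g m / 2" using g_F[OF j, of y] m(2)[OF y(1)] y(2) by auto
  then have "g x \<le> 0" using m(2)[OF x] by simp
  then show ?thesis by (simp add: g_def)
qed

lemma SG_eq_vertex:
  assumes i: "i \<in> {0,1,2}" and x: "x \<in> SG q" and 1: "bary i x \<ge> 1"
  shows "x = q i"
proof -
  have "bary j x = (if j = i then 1 else 0)" if "j \<in> {0,1,2}" for j
    using sum_bary[of x] bary_nonneg[OF _ x, of 0] bary_nonneg[OF _ x, of 1]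
      bary_nonneg[OF _ x, of 2] that i 1 by auto
  then have "(\<Sum>j\<in>{0,1,2}. bary j x *\<^sub>R q j) = (\<Sum>j\<in>{0,1,2}. (if j = i then 1 else 0) *\<^sub>R q j)"
    by (intro sum.cong) simp_all
  also have "\<dots> = q i" using i by auto
  finally show ?thesis using SG_barycentric[OF x] by simp
qed

text \<open>Cell \<open>i\<close> lies where the \<open>i\<close>-th coordinate is at least \<open>1/2\<close>. At a common point both coordinates
  are then \<open>1/2\<close>, so the point is the midpoint of \<open>q i\<close> and \<open>q j\<close>.\<close>

lemma cells_meet_at_vertices:
  assumes ij: "i \<in> {0,1,2}" "j \<in> {0,1,2}" "i \<noteq> j"
    and xy: "x \<in> SG q" "y \<in> SG q" and eq: "F q i x = F q j y"
  shows "x = q j" "y = q i"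
proof -
  have "bary i x + 1 = bary i y" "bary j y + 1 = bary j x"
    using bary_F[OF ij(1) ij(1), of x] bary_F[OF ij(1,2), of y]
      bary_F[OF ij(2) ij(1), of x] bary_F[OF ij(2) ij(2), of y] ij(3) eq by auto
  then have "bary i y \<ge> 1" "bary j x \<ge> 1"
    using bary_nonneg[OF ij(1) xy(1)] bary_nonneg[OF ij(2) xy(2)] by linarith+
  then show "x = q j" "y = q i"
    using SG_eq_vertex[OF ij(1) xy(2)] SG_eq_vertex[OF ij(2) xy(1)] by simp_all
qed

end

section \<open>Harmonic extension\<close>

text \<open>The boundary values that the extension rule gives to subcell \<open>i\<close> of a cell with boundary values
  \<open>b\<close>. For distinct \<open>i\<close>, \<open>j\<close> the numerator is \<open>2 b i + 2 b j + b k\<close> with \<open>k\<close> the third index; in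
  this form the third index need not be named and the symmetry in \<open>i\<close> and \<open>j\<close> is visible.\<close>

definition refine :: "(nat \<Rightarrow> real) \<Rightarrow> nat \<Rightarrow> nat \<Rightarrow> real" where
  "refine b i j = (if j = i then b i else (b i + b j + (\<Sum>k\<in>{0,1,2}. b k)) / 5)"

lemma refine_same: "refine b i i = b i"
  by (simp add: refine_def)

lemma refine_commute: "refine b i j = refine b j i"
  by (simp add: refine_def)

lemma refine_junction:
  assumes "{i,j,k} = {0,1,2}"
  shows "refine b i j = (2 * b i + 2 * b j + b k) / 5"
proof -
  have "card {i,j,k} = 3" by (simp add: assms)
  then have "i \<noteq> j" "i \<noteq> k" "j \<noteq> k" by (auto simp: card_insert_if split: if_splits)
  then show ?thesis unfolding refine_def assms[symmetric] by simp
qed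

text \<open>The contraction behind the convergence of the approximations. The extreme case is a difference
  such as \<open>b i - (2 b i + 2 b k + b l) / 5\<close>, which equals \<open>(2 (b i - b k) + (b i - b l)) / 5\<close>.\<close>

lemma refine_oscillation:
  assumes D: "\<And>i j. i \<in> {0,1,2} \<Longrightarrow> j \<in> {0,1,2} \<Longrightarrow> b i - b j \<le> D"
    and i: "i \<in> {0,1,2}" and j: "j \<in> {0,1,2}" and k: "k \<in> {0,1,2}"
  shows "refine b i j - refine b i k \<le> 3/5 * D"
proof -
  have D0: "D \<ge> 0" using D[OF i i] by simp
  consider "j = k" | "j \<noteq> i" "k \<noteq> i" | "j = i" "k \<noteq> i" | "j \<noteq> i" "k = i" by blast
  then show ?thesis
  proof cases
    case 1
    then show ?thesis using D0 by simp
  next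
    case 2
    then have "refine b i j - refine b i k = (b j - b k) / 5"
      by (simp add: refine_def field_simps)
    then show ?thesis using D[OF j k] D0 by simp
  next
    case 3
    obtain l where l: "{i,k,l} = {0,1,2}" using third_vertex[OF i k] 3 by auto
    then have "l \<in> {0,1,2}" by blast
    then have "b i - b k \<le> D" "b i - b l \<le> D" using D[OF i] k by blast+
    then show ?thesis unfolding 3(1) refine_same refine_junction[OF l] by (simp add: field_simps)
  next
    case 4
    obtain l where l: "{i,j,l} = {0,1,2}" using third_vertex[OF i j] 4 by auto
    then have "l \<in> {0,1,2}" by blast
    then have "b j - b i \<le> D" "b l - b i \<le> D" using D[OF _ i] j by blast+
    then show ?thesis unfolding 4(2) refine_same refine_junction[OF l] by (simp add: field_simps)
  qed
qed

context equilateral_vertices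
begin

lemma vertex_in_cell:
  assumes "i \<in> {0,1,2}" "j \<in> {0,1,2}" "x \<in> SG q" "F q j x = q i"
  shows "j = i" "x = q i"
proof -
  have eq: "F q i (q i) = F q j x" using assms(4) by (simp add: F_vertex)
  show "j = i"
  proof (rule ccontr)
    assume "j \<noteq> i"
    then have "q i = q j"
      using cells_meet_at_vertices(1)[OF assms(1,2) _ vertex_in_SG[OF assms(1)] assms(3) eq] by simp
    then show False using dist_vertices[OF assms(1,2)] \<open>j \<noteq> i\<close> by simp
  qed
  then show "x = q i" using eq injD[OF inj_F] by metis
qed

text \<open>A junction point lies in two subcells, and either may be selected: \<open>approx_F\<close> shows that
  the choice does not influence the values of the approximations.\<close>

definition child :: "real^2 \<Rightarrow> nat" where
  "child x = (SOME i. i \<in> {0,1,2} \<and> x \<in> F q i ` SG q)"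

text \<open>Affine interpolation on the cells of level \<open>n\<close>, between the vertex values that the extension
  rule produces from \<open>b\<close>. The point \<open>2 *\<^sub>R x - q i\<close> is the preimage of \<open>x\<close> under \<open>F q i\<close>.\<close>

primrec approx :: "nat \<Rightarrow> (nat \<Rightarrow> real) \<Rightarrow> real^2 \<Rightarrow> real" where
  "approx 0 b x = (\<Sum>i\<in>{0,1,2}. b i * bary i x)"
| "approx (Suc n) b x = approx n (refine b (child x)) (2 *\<^sub>R x - q (child x))"

lemma child:
  assumes "x \<in> SG q"
  obtains z where "child x \<in> {0,1,2}" "z \<in> SG q" "x = F q (child x) z" "2 *\<^sub>R x - q (child x) = z"
proof -
  have "\<exists>i. i \<in> {0,1,2} \<and> x \<in> F q i ` SG q" using assms SG(3)[of q] by blast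
  then have "child x \<in> {0,1,2} \<and> x \<in> F q (child x) ` SG q"
    unfolding child_def by (rule someI_ex)
  then obtain z where z: "child x \<in> {0,1,2}" "z \<in> SG q" "x = F q (child x) z" by blast
  have "2 *\<^sub>R F q (child x) z - q (child x) = z" by (simp add: F_def)
  then show ?thesis using that[OF z] z(3) by simp
qed

lemma approx_vertex:
  assumes i: "i \<in> {0,1,2}"
  shows "approx n b (q i) = b i"
proof (induction n arbitrary: b)
  case 0
  have "approx 0 b (q i) = (\<Sum>j\<in>{0,1,2}. b j * (if j = i then 1 else 0))"
    unfolding approx.simps by (rule sum.cong) (simp_all only: bary_vertex[OF _ i])
  also have "\<dots> = b i" using i by auto
  finally show ?case .
next
  case (Suc n)
  obtain z where z: "child (q i) \<in> {0,1,2}" "z \<in> SG q" "q i = F q (child (q i)) z"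
    "2 *\<^sub>R q i - q (child (q i)) = z"
    using child[OF vertex_in_SG[OF i]] .
  note v = vertex_in_cell[OF i z(1,2) z(3)[symmetric]]
  show ?case unfolding approx.simps z(4) unfolding v Suc.IH by (rule refine_same)
qed

text \<open>If another subcell is selected at \<open>F q i x\<close>, this point is the junction of the two subcells, and
  both of them assign the value \<open>refine b i j = refine b j i\<close> to it.\<close>

lemma approx_F:
  assumes i: "i \<in> {0,1,2}" and x: "x \<in> SG q"
  shows "approx (Suc n) b (F q i x) = approx n (refine b i) x"
proof -
  define j where "j = child (F q i x)"
  obtain z where z: "j \<in> {0,1,2}" "z \<in> SG q" "F q i x = F q j z" "2 *\<^sub>R F q i x - q j = z"
    using child[OF F_in_SG[OF i x]] unfolding j_def by blast
  have eq: "approx (Suc n) b (F q i x) = approx n (refine b j) z"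
    unfolding approx.simps j_def[symmetric] z(4) ..
  show ?thesis
  proof (cases "i = j")
    case True
    then show ?thesis using eq z(3) injD[OF inj_F, of q j x z] by simp
  next
    case False
    note xz = cells_meet_at_vertices[OF i z(1) False x z(2,3)]
    show ?thesis unfolding eq unfolding xz approx_vertex[OF i] approx_vertex[OF z(1)]
      by (rule refine_commute)
  qed
qed

lemma continuous_on_pieces:
  assumes "\<And>i. i \<in> {0,1,2} \<Longrightarrow> continuous_on (SG q) (\<lambda>x. f (F q i x))"
  shows "continuous_on (SG q) f"
proof -
  have "continuous_on (F q i ` SG q) f" if i: "i \<in> {0,1,2}" for i
  proof -
    have "continuous_on (F q i ` SG q) (\<lambda>y. f (F q i (2 *\<^sub>R y - q i)))"
      by (rule continuous_on_compose2[OF assms[OF i], where f = "\<lambda>y. 2 *\<^sub>R y - q i"])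
        (auto intro!: continuous_intros simp: F_def)
    then show ?thesis by (simp add: F_def)
  qed
  then have "continuous_on (\<Union>i\<in>{0,1,2}. F q i ` SG q) f"
    by (intro continuous_on_closed_Union compact_imp_closed compact_continuous_image
        continuous_on_F SG(1)) auto
  then show ?thesis using SG(3)[of q] by simp
qed

lemma continuous_on_approx: "continuous_on (SG q) (approx n b)"
proof (induction n arbitrary: b)
  case 0
  show ?case unfolding approx.simps by (intro continuous_intros continuous_on_bary)
next
  case (Suc n)
  show ?case
  proof (rule continuous_on_pieces)
    fix i :: nat assume i: "i \<in> {0,1,2}"
    show "continuous_on (SG q) (\<lambda>x. approx (Suc n) b (F q i x))"
      using Suc.IH[of "refine b i"] approx_F[OF i] by (simp cong: continuous_on_cong)
  qed
qed

lemma approx_0_bound: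
  assumes D: "\<And>i. i \<in> {0,1,2} \<Longrightarrow> \<bar>b i - c\<bar> \<le> D" and x: "x \<in> SG q"
  shows "\<bar>approx 0 b x - c\<bar> \<le> D"
proof -
  have "approx 0 b x - (\<Sum>i\<in>{0,1,2}. bary i x) * c = (\<Sum>i\<in>{0,1,2}. bary i x * (b i - c))"
    by (simp add: algebra_simps)
  then have "approx 0 b x - c = (\<Sum>i\<in>{0,1,2}. bary i x * (b i - c))"
    unfolding sum_bary by simp
  also have "\<bar>\<dots>\<bar> \<le> (\<Sum>i\<in>{0,1,2}. bary i x * D)"
    using D bary_nonneg[OF _ x]
    by (intro order_trans[OF sum_abs] sum_mono) (simp only: abs_mult abs_of_nonneg mult_left_mono)
  also have "\<dots> = D"
    unfolding sum_distrib_right[symmetric] sum_bary by simp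
  finally show ?thesis .
qed

text \<open>Each step into a subcell multiplies the oscillation bound by \<open>3/5\<close>. At level \<open>0\<close> both
  approximations stay within \<open>D\<close> of one boundary value, whence the factor \<open>2\<close>.\<close>

lemma approx_step:
  assumes D: "\<And>i j. i \<in> {0,1,2} \<Longrightarrow> j \<in> {0,1,2} \<Longrightarrow> b i - b j \<le> D" and x: "x \<in> SG q"
  shows "\<bar>approx (Suc n) b x - approx n b x\<bar> \<le> 2 * D * (3/5) ^ n"
  using assms
proof (induction n arbitrary: b D x)
  case (0 b D x)
  obtain i z where i: "i \<in> {0,1,2}" and z: "z \<in> SG q" and x: "x = F q i z"
    using 0(2) SG(3)[of q] by blast
  have D: "\<bar>b j - b k\<bar> \<le> D" if "j \<in> {0,1,2}" "k \<in> {0,1,2}" for j k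
    using 0(1)[OF that] 0(1)[OF that(2,1)] by linarith
  have D0: "D \<ge> 0" using D[OF i i] by simp
  have "\<bar>refine b i j - b i\<bar> \<le> D" if "j \<in> {0,1,2}" for j
  proof -
    have "refine b i j - refine b i i \<le> 3/5 * D"
      by (rule refine_oscillation[OF 0(1) i that i])
    moreover have "refine b i i - refine b i j \<le> 3/5 * D"
      by (rule refine_oscillation[OF 0(1) i i that])
    ultimately show ?thesis using D0 unfolding refine_same abs_le_iff by linarith
  qed
  then have "\<bar>approx 0 (refine b i) z - b i\<bar> \<le> D" by (rule approx_0_bound[OF _ z])
  moreover have "\<bar>approx 0 b x - b i\<bar> \<le> D"
    by (rule approx_0_bound[OF D[OF _ i] 0(2)])
  ultimately show ?case unfolding x approx_F[OF i z] by (simp add: abs_le_iff)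
next
  case (Suc n b D x)
  obtain i z where i: "i \<in> {0,1,2}" and z: "z \<in> SG q" and x: "x = F q i z"
    using Suc.prems(2) SG(3)[of q] by blast
  have "\<bar>approx (Suc n) (refine b i) z - approx n (refine b i) z\<bar> \<le> 2 * (3/5 * D) * (3/5) ^ n"
    by (rule Suc.IH[OF refine_oscillation[OF Suc.prems(1) i] z])
  then show ?case unfolding x approx_F[OF i z] by simp
qed

definition harmonic_ext :: "(nat \<Rightarrow> real) \<Rightarrow> real^2 \<Rightarrow> real" where
  "harmonic_ext b x = lim (\<lambda>n. approx n b x)"

lemma uniform_limit_approx: "uniform_limit (SG q) (\<lambda>n. approx n b) (harmonic_ext b) sequentially"
proof -
  define B where "B = (\<Sum>i\<in>{0,1,2}. \<bar>b i\<bar>)"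
  define D where "D = 2 * B"
  have B: "\<bar>b i\<bar> \<le> B" if "i \<in> {0,1,2}" for i
    unfolding B_def using that by (intro member_le_sum) auto
  have D: "b i - b j \<le> D" if "i \<in> {0,1,2}" "j \<in> {0,1,2}" for i j
    using B[OF that(1)] B[OF that(2)] unfolding D_def by linarith
  \<comment> \<open>the limit as a telescoping series, dominated by a geometric one\<close>
  define g where "g x = (\<Sum>k. approx (Suc k) b x - approx k b x)" for x
  have telescope: "(\<Sum>k<n. approx (Suc k) b x - approx k b x) = approx n b x - approx 0 b x" for n x
    by (rule sum_lessThan_telescope)
  have "uniform_limit (SG q) (\<lambda>n x. \<Sum>k<n. approx (Suc k) b x - approx k b x) g sequentially"
    unfolding g_def
  proof (rule Weierstrass_m_test)
    show "norm (approx (Suc k) b x - approx k b x) \<le> 2 * D * (3/5) ^ k" if "x \<in> SG q" for k x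
      using approx_step[OF D that] by simp
    show "summable (\<lambda>k. 2 * D * (3/5) ^ k)" by (intro summable_mult summable_geometric) simp
  qed
  then have "uniform_limit (SG q) (\<lambda>n x. approx n b x - approx 0 b x) g sequentially"
    unfolding telescope .
  then have "uniform_limit (SG q) (\<lambda>n x. (approx n b x - approx 0 b x) + approx 0 b x)
      (\<lambda>x. g x + approx 0 b x) sequentially"
    by (rule uniform_limit_add[OF _ uniform_limit_const])
  then have lim: "uniform_limit (SG q) (\<lambda>n. approx n b) (\<lambda>x. g x + approx 0 b x) sequentially"
    by simp
  have "harmonic_ext b x = g x + approx 0 b x" if "x \<in> SG q" for x
    unfolding harmonic_ext_def using tendsto_uniform_limitI[OF lim that] by (rule limI)
  then show ?thesis using lim by (simp cong: uniform_limit_cong')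
qed

lemma approx_tendsto: "x \<in> SG q \<Longrightarrow> (\<lambda>n. approx n b x) \<longlonglongrightarrow> harmonic_ext b x"
  by (rule tendsto_uniform_limitI[OF uniform_limit_approx])

lemma continuous_on_harmonic_ext: "continuous_on (SG q) (harmonic_ext b)"
  by (rule uniform_limit_theorem[OF _ uniform_limit_approx])
    (simp_all add: continuous_on_approx)

lemma harmonic_ext_vertex:
  assumes "i \<in> {0,1,2}"
  shows "harmonic_ext b (q i) = b i"
proof -
  have "(\<lambda>n. approx n b (q i)) \<longlonglongrightarrow> harmonic_ext b (q i)"
    by (rule approx_tendsto[OF vertex_in_SG[OF assms]])
  then show ?thesis unfolding approx_vertex[OF assms] by (simp add: LIMSEQ_const_iff)
qed

lemma harmonic_ext_F:
  assumes "i \<in> {0,1,2}" "x \<in> SG q"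
  shows "harmonic_ext b (F q i x) = harmonic_ext (refine b i) x"
proof -
  have "(\<lambda>n. approx (Suc n) b (F q i x)) \<longlonglongrightarrow> harmonic_ext b (F q i x)"
    by (rule LIMSEQ_Suc[OF approx_tendsto[OF F_in_SG[OF assms]]])
  then show ?thesis
    unfolding approx_F[OF assms] by (rule LIMSEQ_unique[OF _ approx_tendsto[OF assms(2)]])
qed

text \<open>On the subcell with word \<open>v\<close> the extension is again a harmonic extension, namely of the values
  obtained by refining along \<open>v\<close>. The extension rule on every subcell thereby reduces to the rule on
  the whole gasket.\<close>

lemma harmonic_ext_Fw:
  assumes "v \<in> lists {0,1,2}" "x \<in> SG q"
  shows "harmonic_ext b (Fw q v x) = harmonic_ext (foldl refine b v) x"
  using assms
proof (induction v arbitrary: b rule: list.induct)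
  case (Cons i v)
  then have i: "i \<in> {0,1,2}" and v: "v \<in> lists {0,1,2}" by auto
  show ?case
    unfolding Fw_Cons foldl.simps harmonic_ext_F[OF i Fw_in_SG[OF v Cons.prems(2)]]
    by (rule Cons.IH[OF v Cons.prems(2)])
qed (simp add: Fw_Nil)

lemma harmonic_extension_exists:
  "\<exists>h. harmonic_on_cell q w h \<and> (\<forall>i\<in>{0,1,2}. h (Fw q w (q i)) = b i)"
proof -
  define h where "h y = harmonic_ext b (inv (Fw q w) y)" for y
  have h: "h (Fw q w x) = harmonic_ext b x" for x by (simp add: h_def inv_f_f[OF inj_Fw])
  have "\<forall>i\<in>{0,1,2}. h (Fw q w (q i)) = b i"
    unfolding h using harmonic_ext_vertex by blast
  moreover have "harmonic_on_cell q w h"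
    unfolding harmonic_on_cell_def
  proof (intro conjI ballI allI impI)
    have "continuous_on (cell q w) (inv (Fw q w))"
      unfolding cell_def by (rule continuous_on_inv[OF continuous_on_Fw SG(1)])
        (simp add: inv_f_f[OF inj_Fw])
    then show "continuous_on (cell q w) h"
      unfolding h_def by (rule continuous_on_compose2[OF continuous_on_harmonic_ext])
        (auto simp: cell_def inv_f_f[OF inj_Fw])
  next
    fix v :: "nat list" and i j k assume v: "v \<in> lists {0,1,2}" and ijk: "{i,j,k} = {0,1,2::nat}"
    have i: "i \<in> {0,1,2}" and j: "j \<in> {0,1,2}" and k: "k \<in> {0,1,2}" using ijk by blast+
    have *: "h (Fw q (w @ v) x) = harmonic_ext (foldl refine b v) x" if "x \<in> SG q" for x
      unfolding Fw_append h by (rule harmonic_ext_Fw[OF v that])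
    show "h (Fw q (w @ v) (F q i (q j))) =
        (2 * h (Fw q (w @ v) (q i)) + 2 * h (Fw q (w @ v) (q j)) + h (Fw q (w @ v) (q k))) / 5"
      unfolding *[OF F_in_SG[OF i vertex_in_SG[OF j]]] *[OF vertex_in_SG[OF i]]
        *[OF vertex_in_SG[OF j]] *[OF vertex_in_SG[OF k]]
        harmonic_ext_F[OF i vertex_in_SG[OF j]] harmonic_ext_vertex[OF i]
        harmonic_ext_vertex[OF j] harmonic_ext_vertex[OF k]
      by (rule refine_junction[OF ijk])
  qed
  ultimately show ?thesis by blast
qed

end

section \<open>Geometry of the half gasket\<close>

lemma Fw_replicate: "Fw q (replicate n i) x = (F q i ^^ n) x"
  by (induction n) (simp_all add: Fw_Nil Fw_Cons)

lemma Fw_Y_word: "m \<ge> 1 \<Longrightarrow> Fw q (Y_word m) z = (F q 0 ^^ (m - 1)) (F q 1 z)"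
  by (simp add: Y_word_def Fw_append Fw_replicate Fw_Cons Fw_Nil)

lemma compact_cell: "compact (cell q w)"
  unfolding cell_def by (intro compact_continuous_image continuous_on_Fw SG(1))

lemma y_pt_0: "y_pt q 0 = q 1"
  by (simp add: y_pt_def)

lemma Y_cell_points:
  assumes "m \<ge> 1"
  shows "y_pt q m \<in> cell q (Y_word m)" "y_pt q (m - 1) \<in> cell q (Y_word m)"
    "x_pt q m \<in> cell q (Y_word m)"
  unfolding cell_def Y_word_boundary[OF assms, symmetric]
  by (simp_all add: vertex_in_SG)

lemma Y_cell_subset_Omega_bar: "m \<ge> 1 \<Longrightarrow> cell q (Y_word m) \<subseteq> Omega_bar q"
  by (auto simp: Omega_bar_def)

lemma y_pt_in_Omega_bar: "y_pt q m \<in> Omega_bar q"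
  using Y_cell_points(2)[of "Suc m" q] Y_cell_subset_Omega_bar[of "Suc m" q] by auto

lemma y_pt_tendsto: "(\<lambda>m. y_pt q m) \<longlonglongrightarrow> q 0"
proof -
  have "dist (y_pt q m) (q 0) = dist (q 1) (q 0) * (1/2) ^ m" for m
  proof -
    have "(F q 0 ^^ m) (q 0) = q 0" by (induction m) (simp_all add: F_vertex)
    then show ?thesis
      using dist_Fw[of q "replicate m 0" "q 1" "q 0"]
      by (simp add: Fw_replicate y_pt_def power_one_over)
  qed
  moreover have "(\<lambda>m. dist (q 1) (q 0) * (1/2) ^ m) \<longlonglongrightarrow> 0"
    by (intro tendsto_mult_right_zero LIMSEQ_realpow_zero) auto
  ultimately show ?thesis by (subst tendsto_dist_iff) simp
qed

context equilateral_vertices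
begin

text \<open>The quantity \<open>1 - bary 0\<close> serves as height above \<open>q 0\<close>. It is halved by \<open>F q 0\<close>, and this separates
  the cells of the half gasket: cell \<open>m\<close> occupies the heights from \<open>2\<^sup>-\<^sup>m\<close> to \<open>2\<^sup>1\<^sup>-\<^sup>m\<close>.\<close>

lemma bary_0_Fw_Y_word:
  assumes "m \<ge> 1"
  shows "1 - bary 0 (Fw q (Y_word m) z) = (2 - bary 0 z) / 2 ^ m"
proof -
  have half: "1 - bary 0 (F q 0 x) = (1 - bary 0 x) / 2" for x
    using bary_F[of 0 0 x] by (simp add: field_simps)
  have *: "1 - bary 0 ((F q 0 ^^ n) x) = (1 - bary 0 x) / 2 ^ n" for n x
  proof (induction n)
    case (Suc n)
    then show ?case by (simp add: half)
  qed simp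
  obtain n where m: "m = Suc n" using assms by (cases m) auto
  show ?thesis
    using bary_F[of 0 1 z] unfolding Fw_Y_word[OF assms] * by (simp add: m field_simps)
qed

lemma Y_cell_height:
  assumes m: "m \<ge> 1" and x: "x \<in> cell q (Y_word m)"
  shows "1 / 2 ^ m \<le> 1 - bary 0 x" "1 - bary 0 x \<le> 2 / 2 ^ m"
    "1 - bary 0 x = 1 / 2 ^ m \<Longrightarrow> x = y_pt q m"
proof -
  obtain z where z: "z \<in> SG q" "x = Fw q (Y_word m) z" using x by (auto simp: cell_def)
  have b: "0 \<le> bary 0 z" "bary 0 z \<le> 1" using bary_nonneg[OF _ z(1)] bary_le_1[OF _ z(1)] by auto
  have eq: "1 - bary 0 x = (2 - bary 0 z) / 2 ^ m" unfolding z(2) by (rule bary_0_Fw_Y_word[OF m])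
  show "1 / 2 ^ m \<le> 1 - bary 0 x" "1 - bary 0 x \<le> 2 / 2 ^ m"
    unfolding eq using b by (auto intro!: divide_right_mono)
  show "x = y_pt q m" if "1 - bary 0 x = 1 / 2 ^ m"
  proof -
    have "bary 0 z = 1" using that unfolding eq by simp
    then have "z = q 0" using SG_eq_vertex[OF _ z(1), of 0] by simp
    then show ?thesis using z(2) Y_word_boundary(1)[OF m] by simp
  qed
qed

lemma bary_0_q0: "bary 0 (q 0) = 1"
  using bary_vertex[of 0 0] by simp

lemma q0_notin_Y_cell:
  assumes "m \<ge> 1"
  shows "q 0 \<notin> cell q (Y_word m)"
proof
  assume "q 0 \<in> cell q (Y_word m)"
  from Y_cell_height(1)[OF assms this] have "1 / 2 ^ m \<le> (0::real)" by (simp add: bary_0_q0)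
  moreover have "(0::real) < 1 / 2 ^ m" by simp
  ultimately show False by linarith
qed

text \<open>The height ranges of two cells meet only if the cells are consecutive, and then only in the lowest
  height of the upper cell, which that cell attains at \<open>y_pt q m\<close> alone.\<close>

lemma Y_cells_overlap:
  assumes "1 \<le> m" "m < n" "x \<in> cell q (Y_word m)" "x \<in> cell q (Y_word n)"
  shows "n = Suc m \<and> x = y_pt q m"
proof -
  have m: "1 / 2 ^ m \<le> 1 - bary 0 x" using Y_cell_height(1)[OF assms(1,3)] .
  have n: "1 - bary 0 x \<le> 2 / 2 ^ n" using Y_cell_height(2)[OF _ assms(4)] assms(1,2) by simp
  have "(2::real) ^ Suc m \<le> 2 ^ n" using assms(2) by (intro power_increasing) auto
  then have "2 / 2 ^ n \<le> 1 / (2::real) ^ m" by (simp add: field_simps)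
  then have h: "1 - bary 0 x = 1 / 2 ^ m" using m n by linarith
  have "1 / 2 ^ m \<le> 2 / (2::real) ^ n" using m n by linarith
  then have "(2::real) ^ n \<le> 2 ^ Suc m" by (simp add: field_simps)
  then have "n \<le> Suc m" by (simp only: power_increasing_iff)
  then show ?thesis using assms(2) Y_cell_height(3)[OF assms(1,3) h] by simp
qed

lemma q0_islimpt: "q 0 islimpt Omega_bar q"
proof -
  have "y_pt q (Suc m) \<noteq> q 0" for m
    using q0_notin_Y_cell[of "Suc m"] Y_cell_points(1)[of "Suc m" q] by auto
  then show ?thesis
    unfolding islimpt_sequential using y_pt_in_Omega_bar LIMSEQ_Suc[OF y_pt_tendsto[of q]]
    by (intro exI[of _ "\<lambda>m. y_pt q (Suc m)"]) auto
qed

section \<open>Functions on the half gasket\<close>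

text \<open>The value at \<open>q 0\<close> can be prescribed freely because \<open>q 0\<close> belongs to none of the cells.\<close>

lemma harmonic_function_with_values:
  obtains u where "\<And>m. m \<ge> 1 \<Longrightarrow> harmonic_on_cell q (Y_word m) u"
    "\<And>m. m \<ge> 1 \<Longrightarrow> u (x_pt q m) = b m" "\<And>m. u (y_pt q m) = c m" "u (q 0) = d"
proof -
  have "\<exists>h. harmonic_on_cell q (Y_word m) h \<and> h (y_pt q m) = c m \<and> h (y_pt q (m - 1)) = c (m - 1) \<and>
      h (x_pt q m) = b m" if m: "m \<ge> 1" for m
  proof -
    obtain h where h: "harmonic_on_cell q (Y_word m) h"
      "\<forall>i\<in>{0,1,2}. h (Fw q (Y_word m) (q i)) =
        (if i = 0 then c m else if i = 1 then c (m - 1) else b m)"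
      using harmonic_extension_exists[of "Y_word m" "\<lambda>i. if i = 0 then c m else if i = 1 then c (m - 1) else b m"] by blast
    have "h (y_pt q m) = c m" "h (y_pt q (m - 1)) = c (m - 1)" "h (x_pt q m) = b m"
      using h(2)[rule_format, of 0] h(2)[rule_format, of 1] h(2)[rule_format, of 2] by (simp_all add: Y_word_boundary[OF m, simplified])
    then show ?thesis using h(1) by blast
  qed
  then obtain h where h: "\<And>m. m \<ge> 1 \<Longrightarrow> harmonic_on_cell q (Y_word m) (h m)"
    "\<And>m. m \<ge> 1 \<Longrightarrow> h m (y_pt q m) = c m" "\<And>m. m \<ge> 1 \<Longrightarrow> h m (y_pt q (m - 1)) = c (m - 1)"
    "\<And>m. m \<ge> 1 \<Longrightarrow> h m (x_pt q m) = b m"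
    by metis
  have adjacent: "h m x = h n x"
    if "1 \<le> m" "m < n" "x \<in> cell q (Y_word m)" "x \<in> cell q (Y_word n)" for m n x
  proof -
    have "n = Suc m" "x = y_pt q m" using Y_cells_overlap[OF that] by auto
    then show ?thesis using h(2)[OF that(1)] h(3)[of n] by simp
  qed
  have agree: "h m x = h n x"
    if "1 \<le> m" "1 \<le> n" "x \<in> cell q (Y_word m)" "x \<in> cell q (Y_word n)" for m n x
  proof (cases m n rule: linorder_cases)
    case less
    then show ?thesis by (rule adjacent[OF that(1) _ that(3,4)])
  next
    case greater
    then show ?thesis by (rule adjacent[OF that(2) _ that(4,3), symmetric])
  qed simp
  define u where "u x = (if x = q 0 then d else h (SOME n. n \<ge> 1 \<and> x \<in> cell q (Y_word n)) x)" for x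
  have u: "u x = h m x" if "m \<ge> 1" "x \<in> cell q (Y_word m)" for m x
  proof -
    define n where "n = (SOME n. n \<ge> 1 \<and> x \<in> cell q (Y_word n))"
    have "n \<ge> 1 \<and> x \<in> cell q (Y_word n)"
      unfolding n_def by (rule someI[of _ m]) (use that in blast)
    moreover have "x \<noteq> q 0" using that q0_notin_Y_cell by blast
    ultimately show ?thesis
      using agree[of n m x] that unfolding u_def n_def[symmetric] by simp
  qed
  show ?thesis
  proof (rule that[of u])
    show "harmonic_on_cell q (Y_word m) u" if "m \<ge> 1" for m
      by (rule harmonic_on_cell_cong[OF h(1)[OF that]]) (simp add: u[OF that])
    show "u (x_pt q m) = b m" if "m \<ge> 1" for m
      using u[OF that Y_cell_points(3)[OF that]] h(4)[OF that] by simp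
    show "u (y_pt q m) = c m" for m
      using u[OF _ Y_cell_points(2), of "Suc m"] h(3)[of "Suc m"] by simp
    show "u (q 0) = d" by (simp add: u_def)
  qed
qed

text \<open>Only cells with large \<open>m\<close> reach points of small height, and there the maximum principle bounds
  \<open>u\<close> by its values at three points \<open>y_pt q m\<close>, \<open>y_pt q (m - 1)\<close> and \<open>x_pt q m\<close>. The limit at \<open>q 0\<close>
  is punctured, so it can serve to determine \<open>u (q 0)\<close>.\<close>

lemma harmonic_tendsto_at_q0:
  assumes harm: "\<And>m. m \<ge> 1 \<Longrightarrow> harmonic_on_cell q (Y_word m) u"
    and x: "(\<lambda>m. u (x_pt q m)) \<longlonglongrightarrow> 0" and y: "(\<lambda>m. u (y_pt q m)) \<longlonglongrightarrow> 0"
  shows "(u \<longlongrightarrow> 0) (at (q 0) within Omega_bar q)"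
proof (rule tendstoI)
  fix e :: real assume "e > 0"
  then have e: "e / 2 > 0" by simp
  obtain N1 N2 where N1: "\<And>m. m \<ge> N1 \<Longrightarrow> \<bar>u (x_pt q m)\<bar> < e / 2"
    and N2: "\<And>m. m \<ge> N2 \<Longrightarrow> \<bar>u (y_pt q m)\<bar> < e / 2"
    using LIMSEQ_D[OF x e] LIMSEQ_D[OF y e] by auto
  \<comment> \<open>cell \<open>m\<close> also has the boundary point \<open>y_pt q (m - 1)\<close>, whence the successor\<close>
  define N where "N = Suc (max N1 N2)"
  have small: "\<bar>u z\<bar> \<le> e / 2" if m: "m \<ge> N" and z: "z \<in> cell q (Y_word m)" for m z
  proof (rule harmonic_on_cell_bound[OF _ _ z])
    have m1: "m \<ge> 1" using m by (simp add: N_def)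
    show "harmonic_on_cell q (Y_word m) u" by (rule harm[OF m1])
    have "m \<ge> N1" "m \<ge> N2" "m - 1 \<ge> N2" using m by (auto simp: N_def)
    then have "\<bar>u (y_pt q m)\<bar> < e / 2" "\<bar>u (y_pt q (m - 1))\<bar> < e / 2" "\<bar>u (x_pt q m)\<bar> < e / 2"
      by (simp_all only: N1 N2)
    then show "\<bar>u (Fw q (Y_word m) (q i))\<bar> \<le> e / 2" if "i \<in> {0,1,2}" for i
      using that Y_word_boundary[OF m1] by auto
  qed
  have "q 0 \<in> Omega_bar q" by (simp add: Omega_bar_def)
  then have "(bary 0 \<longlongrightarrow> bary 0 (q 0)) (at (q 0) within Omega_bar q)"
    using continuous_on_bary[of "Omega_bar q" 0] unfolding continuous_on_def by blast
  then have "((\<lambda>z. 1 - bary 0 z) \<longlongrightarrow> 1 - bary 0 (q 0)) (at (q 0) within Omega_bar q)"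
    by (intro tendsto_intros)
  then have "\<forall>\<^sub>F z in at (q 0) within Omega_bar q. 1 - bary 0 z < 1 / 2 ^ N"
    by (rule order_tendstoD) (simp add: bary_0_q0)
  moreover have "\<forall>\<^sub>F z in at (q 0) within Omega_bar q. z \<in> Omega_bar q \<and> z \<noteq> q 0"
    by (simp add: eventually_at_filter)
  ultimately show "\<forall>\<^sub>F z in at (q 0) within Omega_bar q. dist (u z) 0 < e"
  proof eventually_elim
    case (elim z)
    then obtain m where m: "m \<ge> 1" "z \<in> cell q (Y_word m)" by (auto simp: Omega_bar_def)
    have "1 / 2 ^ m < 1 / (2::real) ^ N" using Y_cell_height(1)[OF m] elim(1) by linarith
    then have "(2::real) ^ N < 2 ^ m" by (simp add: field_simps)
    then have "N \<le> m" by simp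
    then show ?case using small[OF _ m(2)] \<open>e > 0\<close> by force
  qed
qed

text \<open>The cells accumulate only at \<open>q 0\<close>. Near any other point, bounding the height from below leaves
  finitely many closed cells, so continuity on each cell suffices there.\<close>

lemma continuous_on_Omega_bar:
  assumes cont: "\<And>m. m \<ge> 1 \<Longrightarrow> continuous_on (cell q (Y_word m)) u"
    and lim: "(u \<longlongrightarrow> u (q 0)) (at (q 0) within Omega_bar q)"
  shows "continuous_on (Omega_bar q) u"
  unfolding continuous_on_eq_continuous_within
proof
  fix x assume x: "x \<in> Omega_bar q"
  show "continuous (at x within Omega_bar q) u"
  proof (cases "x = q 0")
    case True
    then show ?thesis using lim by (simp add: continuous_within)
  next
    case False
    then obtain m where m: "m \<ge> 1" "x \<in> cell q (Y_word m)" using x by (auto simp: Omega_bar_def)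
    \<comment> \<open>\<open>x\<close> may be the lowest point of cell \<open>m\<close>, so cell \<open>m + 1\<close> is needed as well\<close>
    define S where "S = (\<Union>n\<in>{1..Suc m}. cell q (Y_word n))"
    define U where "U = {z. 1 / 2 ^ Suc m < 1 - bary 0 z}"
    have "open U" unfolding U_def
      by (intro open_Collect_less continuous_intros continuous_on_bary)
    have "1 / 2 ^ Suc m < 1 / (2::real) ^ m" by (simp add: field_simps)
    then have "x \<in> U" using Y_cell_height(1)[OF m] unfolding U_def by simp
    have sub: "S \<subseteq> Omega_bar q" unfolding S_def Omega_bar_def by auto
    have "z \<in> S" if zO: "z \<in> Omega_bar q" and zU: "z \<in> U" for z
    proof -
      have "z \<noteq> q 0" using zU by (auto simp: U_def bary_0_q0 not_less)
      then obtain n where n: "n \<ge> 1" "z \<in> cell q (Y_word n)" using zO by (auto simp: Omega_bar_def)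
      have "1 / 2 ^ Suc m < 2 / (2::real) ^ n"
        using Y_cell_height(2)[OF n] zU by (simp add: U_def)
      then have "(2::real) ^ n < 2 ^ Suc (Suc m)" by (simp add: field_simps)
      then have "n < Suc (Suc m)" by (simp only: power_strict_increasing_iff)
      then show ?thesis using n by (auto simp: S_def)
    qed
    then have eq: "at x within Omega_bar q = at x within S"
      using sub by (intro at_within_nhd[OF \<open>x \<in> U\<close> \<open>open U\<close>]) blast
    have "continuous_on S u" unfolding S_def
      by (intro continuous_on_closed_Union compact_imp_closed compact_cell cont) auto
    moreover have "x \<in> S" using m unfolding S_def by auto
    ultimately show ?thesis unfolding eq continuous_on_eq_continuous_within by blast
  qed
qed

end

section \<open>The values at the junctions\<close>

text \<open>The convolution of \<open>a\<close> with the growing mode \<open>3\<^sup>m\<close>, taken over later indices, where it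
  decays.\<close>

definition tail_sum :: "(nat \<Rightarrow> real) \<Rightarrow> nat \<Rightarrow> real" where
  "tail_sum a m = (\<Sum>k. 1 / 3 ^ (k + 1) * a (m + (k + 1)))"

text \<open>The convolution of \<open>a\<close> with the decaying mode \<open>5\<^sup>-\<^sup>m\<close>, taken over earlier indices.\<close>

definition head_sum :: "(nat \<Rightarrow> real) \<Rightarrow> nat \<Rightarrow> real" where
  "head_sum a m = 1 / 5 ^ m * (\<Sum>k=1..m. 5 ^ k * a k)"

lemma geometric_third: "(\<lambda>k. 1 / 3 ^ (k + 1) * c) sums (c / 2)" for c :: real
  using sums_mult2[OF sums_mult[OF geometric_sums[of "1/3::real"], of "1/3"], of c]
  by (simp add: power_one_over)

lemma tail_sum_summable:
  assumes "a \<longlonglongrightarrow> 0"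
  shows "summable (\<lambda>k. 1 / 3 ^ (k + 1) * a (m + (k + 1)) :: real)"
proof -
  obtain K where K: "\<And>n. norm (a n) \<le> K"
    using convergent_imp_Bseq[OF convergentI[OF assms]] unfolding Bseq_def by blast
  show ?thesis
  proof (rule summable_comparison_test'[OF sums_summable[OF geometric_third[of K]]])
    show "norm (1 / 3 ^ (k + 1) * a (m + (k + 1))) \<le> 1 / 3 ^ (k + 1) * K" for k
      using K[of "m + (k + 1)"] by (simp add: abs_mult divide_right_mono)
  qed
qed

lemma tail_sum_step:
  assumes "a \<longlonglongrightarrow> 0"
  shows "tail_sum a m = (a (Suc m) + tail_sum a (Suc m)) / 3"
proof -
  have "tail_sum a m = (\<Sum>k. 1 / 3 ^ (Suc k + 1) * a (m + (Suc k + 1))) + 1 / 3 ^ (0 + 1) * a (m + (0 + 1))"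
    unfolding tail_sum_def using suminf_split_head[OF tail_sum_summable[OF assms, of m]] by simp
  also have "(\<Sum>k. 1 / 3 ^ (Suc k + 1) * a (m + (Suc k + 1))) =
      (\<Sum>k. 1 / 3 * (1 / 3 ^ (k + 1) * a (Suc m + (k + 1))))"
    by (rule suminf_cong) simp
  also have "\<dots> = 1 / 3 * tail_sum a (Suc m)"
    unfolding tail_sum_def by (rule suminf_mult[OF tail_sum_summable[OF assms]])
  finally show ?thesis by (simp add: add_divide_distrib)
qed

lemma tail_sum_tendsto:
  assumes a: "a \<longlonglongrightarrow> 0"
  shows "tail_sum a \<longlonglongrightarrow> 0"
proof (rule LIMSEQ_I)
  fix e :: real assume "e > 0"
  then obtain N where N: "\<And>n. n \<ge> N \<Longrightarrow> \<bar>a n\<bar> < e" using LIMSEQ_D[OF a] by auto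
  have "\<bar>tail_sum a m\<bar> \<le> e / 2" if m: "m \<ge> N" for m
  proof -
    have "norm (\<Sum>k. 1 / 3 ^ (k + 1) * a (m + (k + 1))) \<le> (\<Sum>k. 1 / 3 ^ (k + 1) * e)"
    proof (rule norm_suminf_le[OF _ sums_summable[OF geometric_third]])
      show "norm (1 / 3 ^ (k + 1) * a (m + (k + 1))) \<le> 1 / 3 ^ (k + 1) * e" for k
        using N[of "m + (k + 1)"] m by (simp add: abs_mult divide_right_mono)
    qed
    also have "\<dots> = e / 2" by (rule sums_unique[OF geometric_third, symmetric])
    finally show ?thesis by (simp add: tail_sum_def)
  qed
  then have "\<forall>m\<ge>N. norm (tail_sum a m - 0) < e" using \<open>e > 0\<close> by fastforce
  then show "\<exists>N. \<forall>m\<ge>N. norm (tail_sum a m - 0) < e" by blast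
qed

lemma head_sum_Suc: "head_sum a (Suc m) = head_sum a m / 5 + a (Suc m)"
  by (simp add: head_sum_def field_simps)

text \<open>From the index \<open>N\<close> on where \<open>\<bar>a n\<bar> < e/2\<close>, the recursion of \<open>head_sum_Suc\<close> contracts by \<open>1/5\<close> towards
  the interval of radius \<open>5/8 e\<close> about \<open>0\<close>; this radius is the fixed point of \<open>t = t/5 + e/2\<close>.\<close>

lemma head_sum_tendsto:
  assumes a: "a \<longlonglongrightarrow> 0"
  shows "head_sum a \<longlonglongrightarrow> 0"
proof (rule LIMSEQ_I)
  fix e :: real assume "e > 0"
  then have "e / 2 > 0" by simp
  then obtain N where N: "\<And>n. n \<ge> N \<Longrightarrow> \<bar>a n\<bar> < e / 2" using LIMSEQ_D[OF a] by fastforce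
  have bound: "\<bar>head_sum a (N + k)\<bar> \<le> \<bar>head_sum a N\<bar> * (1/5) ^ k + 5/8 * e" for k
  proof (induction k)
    case 0
    then show ?case using \<open>e > 0\<close> by simp
  next
    case (Suc k)
    have "\<bar>head_sum a (N + Suc k)\<bar> \<le> \<bar>head_sum a (N + k)\<bar> / 5 + \<bar>a (Suc (N + k))\<bar>"
      unfolding add_Suc_right head_sum_Suc
      using abs_triangle_ineq[of "head_sum a (N + k) / 5" "a (Suc (N + k))"] by simp
    also have "\<dots> \<le> (\<bar>head_sum a N\<bar> * (1/5) ^ k + 5/8 * e) / 5 + e / 2"
      using Suc.IH N[of "Suc (N + k)"] by (intro add_mono divide_right_mono) auto
    also have "\<dots> = \<bar>head_sum a N\<bar> * (1/5) ^ Suc k + 5/8 * e" by (simp add: field_simps)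
    finally show ?case .
  qed
  have "(\<lambda>k. \<bar>head_sum a N\<bar> * (1/5) ^ k) \<longlonglongrightarrow> 0"
    by (intro tendsto_mult_right_zero LIMSEQ_realpow_zero) auto
  moreover have "e / 4 > 0" using \<open>e > 0\<close> by simp
  ultimately obtain K where K: "\<And>k. k \<ge> K \<Longrightarrow> \<bar>head_sum a N\<bar> * (1/5) ^ k < e / 4"
    using LIMSEQ_D[of _ "0::real" "e / 4"] by (fastforce simp: abs_mult)
  have "\<bar>head_sum a n\<bar> < e" if "n \<ge> N + K" for n
  proof -
    have "K \<le> n - N" "N + (n - N) = n" using that by auto
    then show ?thesis using bound[of "n - N"] K[of "n - N"] \<open>e > 0\<close> by simp
  qed
  then have "\<forall>n\<ge>N + K. norm (head_sum a n - 0) < e" by simp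
  then show "\<exists>N. \<forall>n\<ge>N. norm (head_sum a n - 0) < e" by blast
qed

text \<open>The value at \<open>m = 1\<close> is given by a formula of its own in \<open>y_value\<close>; after the first term of
  \<open>tail_sum a 0\<close> is split off, it agrees with the general one.\<close>

lemma y_value_eq:
  assumes "a \<longlonglongrightarrow> 0"
  shows "y_value a m = (a 0 - 9/7 * tail_sum a 0) / 5 ^ m + 2/7 * head_sum a m + 9/7 * tail_sum a m"
proof (cases "m = 1")
  case False
  then show ?thesis by (simp add: y_value_def tail_sum_def head_sum_def field_simps)
next
  case True
  have "(\<Sum>k. 1 / 3 ^ (k + 2) * a (k + 2)) = (\<Sum>k. 1 / 3 * (1 / 3 ^ (k + 1) * a (1 + (k + 1))))"
    by (rule suminf_cong) (simp add: numeral_2_eq_2)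
  also have "\<dots> = 1 / 3 * tail_sum a 1"
    unfolding tail_sum_def by (rule suminf_mult[OF tail_sum_summable[OF assms]])
  finally show ?thesis
    using tail_sum_step[OF assms, of 0] by (simp add: True y_value_def head_sum_def field_simps)
qed

text \<open>As \<open>y_pt q 0 = q 1\<close>, this makes the prescribed value at \<open>q 1\<close> the initial value of the recurrence.\<close>

lemma y_value_0:
  assumes "a \<longlonglongrightarrow> 0"
  shows "y_value a 0 = a 0"
  by (simp add: y_value_eq[OF assms] head_sum_def)

lemma y_value_tendsto:
  assumes "a \<longlonglongrightarrow> 0"
  shows "y_value a \<longlonglongrightarrow> 0"
proof -
  have "(\<lambda>m. (a 0 - 9/7 * tail_sum a 0) * (1/5) ^ m + 2/7 * head_sum a m + 9/7 * tail_sum a m) \<longlonglongrightarrow> 0"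
    by (intro tendsto_add_zero tendsto_mult_right_zero LIMSEQ_realpow_zero
        head_sum_tendsto tail_sum_tendsto assms) auto
  moreover have "y_value a = (\<lambda>m. (a 0 - 9/7 * tail_sum a 0) * (1/5) ^ m + 2/7 * head_sum a m + 9/7 * tail_sum a m)"
    by (simp add: fun_eq_iff y_value_eq[OF assms] power_one_over)
  ultimately show ?thesis by simp
qed

lemma y_value_recurrence:
  assumes "a \<longlonglongrightarrow> 0" "m \<ge> 1"
  shows "5 * y_value a (m + 1) - 16 * y_value a m + 3 * y_value a (m - 1) = - 3 * a m - 5 * a (m + 1)"
proof -
  obtain n where m: "m = Suc n" using assms(2) by (cases m) auto
  define e where "e = (a 0 - 9/7 * tail_sum a 0) / 5 ^ n"
  have "y_value a n = e + 2/7 * head_sum a n + 9/7 * tail_sum a n"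
    "y_value a (Suc n) = e / 5 + 2/7 * head_sum a (Suc n) + 9/7 * tail_sum a (Suc n)"
    "y_value a (Suc (Suc n)) = e / 25 + 2/7 * head_sum a (Suc (Suc n)) + 9/7 * tail_sum a (Suc (Suc n))"
    unfolding y_value_eq[OF assms(1)] e_def by simp_all
  moreover have "3 * tail_sum a n = a (Suc n) + tail_sum a (Suc n)"
    "3 * tail_sum a (Suc n) = a (Suc (Suc n)) + tail_sum a (Suc (Suc n))"
    by (simp_all add: tail_sum_step[OF assms(1), of n] tail_sum_step[OF assms(1), of "Suc n"])
  ultimately have "5 * y_value a (Suc (Suc n)) - 16 * y_value a (Suc n) + 3 * y_value a n =
      - 3 * a (Suc n) - 5 * a (Suc (Suc n))"
    using head_sum_Suc[of a n] head_sum_Suc[of a "Suc n"] by linarith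
  then show ?thesis by (simp add: m)
qed

lemma normal_derivatives_match_iff:
  fixes y y' y'' c c' :: real
  shows "(5/3) ^ m * (2 * y - y' - c) + (5/3) ^ (m + 1) * (2 * y - y'' - c') = 0 \<longleftrightarrow>
    5 * y'' - 16 * y + 3 * y' = - 3 * c - 5 * c'"
proof -
  have "(5/3) ^ m * (2 * y - y' - c) + (5/3) ^ (m + 1) * (2 * y - y'' - c') =
      (5/3) ^ m * ((- 3 * c - 5 * c' - (5 * y'' - 16 * y + 3 * y')) / 3)"
    by (simp add: field_simps)
  then show ?thesis by (simp only:) auto
qed

lemma solves_bvp_iff:
  "solves_bvp q a u \<longleftrightarrow>
    (\<forall>m\<ge>1. harmonic_on_cell q (Y_word m) u) \<and> u (q 1) = a 0 \<and> (\<forall>m\<ge>1. u (x_pt q m) = a m) \<and>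
    (\<forall>m\<ge>1. 5 * u (y_pt q (m + 1)) - 16 * u (y_pt q m) + 3 * u (y_pt q (m - 1)) =
      - 3 * a m - 5 * a (m + 1))"
  unfolding solves_bvp_def laplacian_zero_def normal_derivatives_match_iff by auto

text \<open>The operator of the recurrence factors through its roots: \<open>d m = e (m + 1) - e m / 5\<close> satisfies
  \<open>d (m + 1) = 3 d m\<close>, so boundedness forces \<open>d = 0\<close>, and then \<open>e\<close> is geometric with initial value \<open>0\<close>.\<close>

lemma bounded_recurrence_zero:
  fixes e :: "nat \<Rightarrow> real"
  assumes rec: "\<And>m. m \<ge> 1 \<Longrightarrow> 5 * e (m + 1) - 16 * e m + 3 * e (m - 1) = 0"
    and e0: "e 0 = 0" and "Bseq e"
  shows "e m = 0"
proof -
  define d where "d m = e (Suc m) - e m / 5" for m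
  have "d (Suc m) = 3 * d m" for m
    using rec[of "Suc m"] by (simp add: d_def)
  then have d: "d m = 3 ^ m * d 0" for m by (induction m) simp_all
  obtain K where K: "K > 0" "\<And>n. norm (e n) \<le> K" using \<open>Bseq e\<close> unfolding Bseq_def by blast
  have bd: "\<bar>d m\<bar> \<le> 2 * K" for m
    using K(2)[of "Suc m"] K(2)[of m] abs_triangle_ineq4[of "e (Suc m)" "e m / 5"] by (simp add: d_def)
  have "d 0 = 0"
  proof (rule ccontr)
    assume "d 0 \<noteq> 0"
    obtain n where "2 * K / \<bar>d 0\<bar> < 3 ^ n" using real_arch_pow[of 3] by auto
    then have "2 * K < \<bar>d n\<bar>" using \<open>d 0 \<noteq> 0\<close> d[of n] by (simp add: field_simps abs_mult)
    then show False using bd[of n] by simp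
  qed
  then have "d m = 0" for m using d[of m] by simp
  then have step: "e (Suc m) = e m / 5" for m unfolding d_def by (simp only: right_minus_eq)
  show ?thesis by (induction m) (simp_all only: e0 step div_0)
qed

theorem theorem2p4:
  fixes q :: "nat \<Rightarrow> real^2" and a :: "nat \<Rightarrow> real"
  assumes "equilateral q" and "a \<longlonglongrightarrow> 0"
  shows "(\<exists>u. extends_values q a u) \<and>
    (\<forall>u. extends_values q a u \<longrightarrow>
       solves_bvp q a u \<and> continuous_on (Omega_bar q) u \<and>
       (\<forall>v. solves_bvp q a v \<and> continuous_on (Omega_bar q) v \<longrightarrow>
          (\<forall>x\<in>Omega_bar q. v x = u x)))"
proof -
  interpret equilateral_vertices q by unfold_locales (rule assms(1))
  note a = assms(2)
  have nontriv: "at (q 0) within Omega_bar q \<noteq> bot"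
    using q0_islimpt by (simp add: trivial_limit_within)
  have limit: "(u \<longlongrightarrow> 0) (at (q 0) within Omega_bar q)"
    if harm: "\<And>m. m \<ge> 1 \<Longrightarrow> harmonic_on_cell q (Y_word m) u"
      and x: "\<And>m. m \<ge> 1 \<Longrightarrow> u (x_pt q m) = a m" and y: "\<And>m. u (y_pt q m) = y_value a m" for u
  proof (rule harmonic_tendsto_at_q0[OF harm])
    show "(\<lambda>m. u (x_pt q m)) \<longlonglongrightarrow> 0"
      using a by (rule Lim_transform_eventually) (auto simp: eventually_sequentially x intro!: exI[of _ 1])
    show "(\<lambda>m. u (y_pt q m)) \<longlonglongrightarrow> 0" unfolding y by (rule y_value_tendsto[OF a])
  qed
  have "\<exists>u. extends_values q a u"
  proof -
    obtain u where u: "\<And>m. m \<ge> 1 \<Longrightarrow> harmonic_on_cell q (Y_word m) u"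
      "\<And>m. m \<ge> 1 \<Longrightarrow> u (x_pt q m) = a m" "\<And>m. u (y_pt q m) = y_value a m" "u (q 0) = 0"
      using harmonic_function_with_values by metis
    have "u (q 1) = a 0" using u(3)[of 0] by (simp add: y_pt_0 y_value_0[OF a])
    moreover have "u (q 0) = Lim (at (q 0) within Omega_bar q) u"
      using tendsto_Lim[OF nontriv limit[OF u(1-3)]] u(4) by simp
    ultimately show ?thesis unfolding extends_values_def using u(1-3) by blast
  qed
  moreover have "solves_bvp q a u \<and> continuous_on (Omega_bar q) u \<and>
       (\<forall>v. solves_bvp q a v \<and> continuous_on (Omega_bar q) v \<longrightarrow> (\<forall>x\<in>Omega_bar q. v x = u x))"
    if ext: "extends_values q a u" for u
  proof -
    have harm: "\<And>m. m \<ge> 1 \<Longrightarrow> harmonic_on_cell q (Y_word m) u"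
      and u1: "u (q 1) = a 0" and ux: "\<And>m. m \<ge> 1 \<Longrightarrow> u (x_pt q m) = a m"
      and uy1: "\<And>m. m \<ge> 1 \<Longrightarrow> u (y_pt q m) = y_value a m"
      and u0: "u (q 0) = Lim (at (q 0) within Omega_bar q) u"
      using ext unfolding extends_values_def by blast+
    have uy: "u (y_pt q m) = y_value a m" for m
      using uy1[of m] u1 by (cases "m = 0") (simp_all add: y_pt_0 y_value_0[OF a])
    have lim: "(u \<longlongrightarrow> u (q 0)) (at (q 0) within Omega_bar q)"
      using limit[OF harm ux uy] tendsto_Lim[OF nontriv limit[OF harm ux uy]] u0 by simp
    have sol: "solves_bvp q a u"
      unfolding solves_bvp_iff uy
      by (intro conjI allI impI harm u1 ux y_value_recurrence[OF a])
    have cont: "continuous_on (Omega_bar q) u"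
      using harm lim by (intro continuous_on_Omega_bar) (auto simp: harmonic_on_cell_def)
    have "v x = u x" if v: "solves_bvp q a v" "continuous_on (Omega_bar q) v" and x: "x \<in> Omega_bar q" for v x
    proof -
      have vharm: "\<And>m. m \<ge> 1 \<Longrightarrow> harmonic_on_cell q (Y_word m) v"
        and vx: "\<And>m. m \<ge> 1 \<Longrightarrow> v (x_pt q m) = a m"
        using v(1) unfolding solves_bvp_iff by simp_all
      have rec: "5 * f (y_pt q (m + 1)) - 16 * f (y_pt q m) + 3 * f (y_pt q (m - 1)) = - 3 * a m - 5 * a (m + 1)"
        if "solves_bvp q a f" "m \<ge> 1" for f m
        using that unfolding solves_bvp_iff by simp
      have conv: "(\<lambda>m. f (y_pt q m)) \<longlonglongrightarrow> f (q 0)" if "continuous_on (Omega_bar q) f" for f :: "real^2 \<Rightarrow> real"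
        by (rule continuous_on_tendsto_compose[OF that y_pt_tendsto])
          (simp_all add: y_pt_in_Omega_bar, simp add: Omega_bar_def)
      define e where "e m = v (y_pt q m) - u (y_pt q m)" for m
      have "e \<longlonglongrightarrow> v (q 0) - u (q 0)"
        unfolding e_def by (intro tendsto_diff conv v cont)
      then have bseq: "Bseq e" by (intro convergent_imp_Bseq convergentI)
      have e0: "e 0 = 0"
        using v(1) u1 by (simp add: e_def y_pt_0 solves_bvp_def)
      have e_rec: "5 * e (m + 1) - 16 * e m + 3 * e (m - 1) = 0" if "m \<ge> 1" for m
        using rec[OF v(1) that] rec[OF sol that] by (simp add: e_def)
      have "e m = 0" for m by (rule bounded_recurrence_zero[OF e_rec e0 bseq])
      then have vy: "v (y_pt q m) = u (y_pt q m)" for m by (simp add: e_def)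
      show ?thesis
      proof (cases "x = q 0")
        case True
        have "(\<lambda>m. v (y_pt q m)) \<longlonglongrightarrow> u (q 0)" unfolding vy by (rule conv[OF cont])
        then show ?thesis using LIMSEQ_unique[OF conv[OF v(2)]] True by blast
      next
        case False
        then obtain m where m: "m \<ge> 1" "x \<in> cell q (Y_word m)" using x by (auto simp: Omega_bar_def)
        show ?thesis
          by (rule harmonic_on_cell_unique[OF vharm[OF m(1)] harm[OF m(1)] _ m(2)])
            (auto simp: Y_word_boundary[OF m(1), simplified] vy vx[OF m(1)] ux[OF m(1)])
      qed
    qed
    then show ?thesis using sol cont by blast
  qed
  ultimately show ?thesis by blast
qed

end
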